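(* Let $\sigma\in\mathbb{P}$, $m,k\in\mathbb{M}$ with $k\leq|n|^c$ for some standard $c$, and let $A$ be a $k$-uniform $(m,k,\sigma)$-WPHP-array. Then the size of $A$ is at most $m\cdot\frac{(n+1-|\sigma|)!}{(n+1-|\sigma|-k)!}$.
   Context: $\mathbb{M}$ is a countable nonstandard model of true arithmetic (in the language with $0,1,\lfloor x/2\rfloor,|x|$ (bit-length), $+,\cdot,\#,<$), $n\in\mathbb{M}$ is nonstandard, $[x]=\{y\in\mathbb{M}:y<x\}$. $\mathbb{P}$ is the set of partial injective functions $\sigma\in\mathbb{M}$ from $[n+1]$ to $[n]$ with $|\sigma|\leq|n|^c$ for some standard $c$; $\tau\leq\sigma$ means $\tau\supseteq\sigma$; $\sigma\|\tau$ (compatible) iff $\sigma\cup\tau\in\mathbb{P}$, otherwise $\sigma\perp\tau$. All objects are elements of $\mathbb{M}$ and counting is done in $\mathbb{M}$. An $(m,k,\sigma)$-WPHP-array is an array $A\in\mathbb{M}$ indexed by $[2m]\times[m]$ whose entries are sets of conditions of size at most $k$, each compatible with $\sigma$ and disjoint from $\sigma$, such that: (1) for $a\neq a'$, $b\neq b'$: $A(a,b)\cap A(a',b)=A(a,b)\cap A(a,b')=\emptyset$; (2) distinct $\tau\in A(a,b)$, $\tau'\in A(a',b)$ are incompatible; (3) distinct $\tau\in A(a,b)$, $\tau'\in A(a,b')$ are incompatible; (4) for every $\rho\leq\sigma$ in $\mathbb{P}$ and every $a\in[2m]$ there are $b\in[m]$, $\tau\in A(a,b)$ with $\tau\|\rho$.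 The size of $A$ is $\sum_{a,b}|A(a,b)|$. $A$ is $k$-uniform if every condition in $\bigcup_{a,b}A(a,b)$ has size exactly $k$. *)

theory Defs
  imports "HOL-Library.Countable_Set"
begin

record 'a arith =
  zero :: 'a  ("\<zero>\<index>")
  one :: 'a  ("\<one>\<index>")
  half :: "'a \<Rightarrow> 'a"
  len :: "'a \<Rightarrow> 'a"
  add :: "'a \<Rightarrow> 'a \<Rightarrow> 'a"  (infixl "\<oplus>\<index>" 65)
  mul :: "'a \<Rightarrow> 'a \<Rightarrow> 'a"  (infixl "\<otimes>\<index>" 70)
  smash :: "'a \<Rightarrow> 'a \<Rightarrow> 'a"  (infixl "\<sharp>\<index>" 75)
  less :: "'a \<Rightarrow> 'a \<Rightarrow> bool"  (infix "\<prec>\<index>" 50)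

text \<open>\<open>bitlen x\<close> is the length of the binary notation of \<open>x\<close>, with \<open>bitlen 0 = 0\<close>.\<close>

definition bitlen :: "nat \<Rightarrow> nat" where
  "bitlen x = (LEAST l. x < 2 ^ l)"

definition nat_arith :: "nat arith" where
  "nat_arith = \<lparr>zero = 0, one = 1, half = (\<lambda>x. x div 2), len = bitlen, add = (+), mul = (*),
     smash = (\<lambda>x y. 2 ^ (bitlen x * bitlen y)), less = (<)\<rparr>"

datatype tm = Var nat | Zero | One | Half tm | Len tm | Add tm tm | Mul tm tm | Smash tm tm

datatype fm = Equal tm tm | Less tm tm | Neg fm | Conj fm fm | Forall nat fm

primrec tm_val :: "'a arith \<Rightarrow> (nat \<Rightarrow> 'a) \<Rightarrow> tm \<Rightarrow> 'a" where
  "tm_val M e (Var i) = e i"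
| "tm_val M e Zero = zero M"
| "tm_val M e One = one M"
| "tm_val M e (Half t) = half M (tm_val M e t)"
| "tm_val M e (Len t) = len M (tm_val M e t)"
| "tm_val M e (Add s t) = add M (tm_val M e s) (tm_val M e t)"
| "tm_val M e (Mul s t) = mul M (tm_val M e s) (tm_val M e t)"
| "tm_val M e (Smash s t) = smash M (tm_val M e s) (tm_val M e t)"

primrec sat :: "'a arith \<Rightarrow> (nat \<Rightarrow> 'a) \<Rightarrow> fm \<Rightarrow> bool" where
  "sat M e (Equal s t) \<longleftrightarrow> tm_val M e s = tm_val M e t"
| "sat M e (Less s t) \<longleftrightarrow> less M (tm_val M e s) (tm_val M e t)"
| "sat M e (Neg p) \<longleftrightarrow> \<not> sat M e p"
| "sat M e (Conj p q) \<longleftrightarrow> sat M e p \<and> sat M e q"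
| "sat M e (Forall i p) \<longleftrightarrow> (\<forall>x. sat M (e(i := x)) p)"

primrec tm_vars :: "tm \<Rightarrow> nat set" where
  "tm_vars (Var i) = {i}"
| "tm_vars Zero = {}"
| "tm_vars One = {}"
| "tm_vars (Half t) = tm_vars t"
| "tm_vars (Len t) = tm_vars t"
| "tm_vars (Add s t) = tm_vars s \<union> tm_vars t"
| "tm_vars (Mul s t) = tm_vars s \<union> tm_vars t"
| "tm_vars (Smash s t) = tm_vars s \<union> tm_vars t"

primrec free_vars :: "fm \<Rightarrow> nat set" where
  "free_vars (Equal s t) = tm_vars s \<union> tm_vars t"
| "free_vars (Less s t) = tm_vars s \<union> tm_vars t"
| "free_vars (Neg p) = free_vars p"
| "free_vars (Conj p q) = free_vars p \<union> free_vars q"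
| "free_vars (Forall i p) = free_vars p - {i}"

definition models :: "'a arith \<Rightarrow> fm \<Rightarrow> bool" where
  "models M p \<longleftrightarrow> (\<forall>e. sat M e p)"

definition true_arithmetic :: "fm set" where
  "true_arithmetic = {p. free_vars p = {} \<and> models nat_arith p}"

primrec std :: "'a arith \<Rightarrow> nat \<Rightarrow> 'a" where
  "std M 0 = zero M"
| "std M (Suc i) = add M (std M i) (one M)"

definition countable_nonstandard_model :: "'a arith \<Rightarrow> bool" where
  "countable_nonstandard_model M \<longleftrightarrow>
     (\<forall>p \<in> true_arithmetic. models M p) \<and> countable (UNIV :: 'a set) \<and> range (std M) \<noteq> UNIV"

text \<open>
  Everything below is evaluated inside \<open>M\<close>: apart from the standard exponents \<open>c :: nat\<close>, all
  quantifiers range over elements of \<open>M\<close>, and finite sets, functions and sequences are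
  represented by their codes in \<open>M\<close>. Uses of \<open>THE\<close> name elements which exist and are unique in
  the situations of interest when \<open>M\<close> satisfies true arithmetic.
\<close>

context
  fixes M :: "'a arith" (structure)
begin

definition le :: "'a \<Rightarrow> 'a \<Rightarrow> bool"  (infix "\<preceq>" 50) where
  "x \<preceq> y \<longleftrightarrow> x \<prec> y \<or> x = y"

definition seg :: "'a \<Rightarrow> 'a set" where
  "seg x = {y. y \<prec> x}"

definition two :: 'a where
  "two = \<one> \<oplus> \<one>"

primrec pow :: "'a \<Rightarrow> nat \<Rightarrow> 'a" where
  "pow x 0 = \<one>"
| "pow x (Suc c) = pow x c \<otimes> x"

text \<open>Meaningful for \<open>y \<preceq> x\<close> only.\<close>

definition diff :: "'a \<Rightarrow> 'a \<Rightarrow> 'a"  (infixl "\<ominus>" 65) where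
  "x \<ominus> y = (THE z. y \<oplus> z = x)"

definition quot :: "'a \<Rightarrow> 'a \<Rightarrow> 'a" where
  "quot x y = (THE q. \<exists>r. r \<prec> y \<and> x = q \<otimes> y \<oplus> r)"

text \<open>
  Ackermann coding: \<open>s\<close> codes the set of those \<open>x\<close> for which the bit of \<open>s\<close> at position \<open>x\<close> is 1,
  that is, \<open>s = (2 * u + 1) * 2 ^ x + v\<close> with \<open>v < 2 ^ x\<close>. Here \<open>\<one> \<sharp> z\<close> is \<open>2\<close> to the power
  \<open>len M z\<close>, and every \<open>x\<close> is of the form \<open>len M z\<close>.
\<close>

definition elems :: "'a \<Rightarrow> 'a set" where
  "elems s = {x. \<exists>z u v. len M z = x \<and> v \<prec> \<one> \<sharp> z \<and> s = (two \<otimes> u \<oplus> \<one>) \<otimes> (\<one> \<sharp> z) \<oplus> v}"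

text \<open>Cantor pairing.\<close>

definition pair :: "'a \<Rightarrow> 'a \<Rightarrow> 'a" where
  "pair x y = half M ((x \<oplus> y) \<otimes> (x \<oplus> y \<oplus> \<one>)) \<oplus> y"

text \<open>\<open>f\<close> codes (the graph of) a function with domain exactly \<open>D\<close>.\<close>

definition fun_on :: "'a \<Rightarrow> 'a set \<Rightarrow> bool" where
  "fun_on f D \<longleftrightarrow>
     (\<forall>p \<in> elems f. \<exists>x y. x \<in> D \<and> p = pair x y) \<and> (\<forall>x \<in> D. \<exists>!y. pair x y \<in> elems f)"

definition app :: "'a \<Rightarrow> 'a \<Rightarrow> 'a" where
  "app f x = (THE y. pair x y \<in> elems f)"

text \<open>The cardinality, in the sense of \<open>M\<close>, of the set coded by \<open>s\<close>.\<close>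

definition mcard :: "'a \<Rightarrow> 'a" where
  "mcard s = (THE c. \<exists>f. fun_on f (elems s) \<and> bij_betw (app f) (elems s) (seg c))"

text \<open>
  \<open>iter a g l\<close> is the last entry of the sequence \<open>p\<close> in \<open>M\<close> of length \<open>l + 1\<close> that satisfies
  \<open>p 0 = a\<close> and \<open>p (i + 1) = g i (p i)\<close> for \<open>i < l\<close>.
\<close>

definition iter :: "'a \<Rightarrow> ('a \<Rightarrow> 'a \<Rightarrow> 'a) \<Rightarrow> 'a \<Rightarrow> 'a" where
  "iter a g l = (THE y. \<exists>p. fun_on p (seg (l \<oplus> \<one>)) \<and> app p \<zero> = a \<and>
     (\<forall>i. i \<prec> l \<longrightarrow> app p (i \<oplus> \<one>) = g i (app p i)) \<and> app p l = y)"

definition msum :: "'a \<Rightarrow> ('a \<Rightarrow> 'a) \<Rightarrow> 'a" where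
  "msum l f = iter \<zero> (\<lambda>i s. s \<oplus> f i) l"

definition mfact :: "'a \<Rightarrow> 'a" where
  "mfact l = iter \<one> (\<lambda>i y. y \<otimes> (i \<oplus> \<one>)) l"

definition partial_injection :: "'a \<Rightarrow> 'a \<Rightarrow> bool" where
  "partial_injection n \<sigma> \<longleftrightarrow>
     (\<forall>p \<in> elems \<sigma>. \<exists>x y. x \<in> seg (n \<oplus> \<one>) \<and> y \<in> seg n \<and> p = pair x y) \<and>
     (\<forall>x y y'. pair x y \<in> elems \<sigma> \<and> pair x y' \<in> elems \<sigma> \<longrightarrow> y = y') \<and>
     (\<forall>x x' y. pair x y \<in> elems \<sigma> \<and> pair x' y \<in> elems \<sigma> \<longrightarrow> x = x')"

definition conds :: "'a \<Rightarrow> 'a set" where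
  "conds n = {\<sigma>. partial_injection n \<sigma> \<and> (\<exists>c. mcard \<sigma> \<preceq> pow (len M n) c)}"

definition extends :: "'a \<Rightarrow> 'a \<Rightarrow> bool" where
  "extends \<tau> \<sigma> \<longleftrightarrow> elems \<sigma> \<subseteq> elems \<tau>"

definition compatible :: "'a \<Rightarrow> 'a \<Rightarrow> 'a \<Rightarrow> bool" where
  "compatible n \<sigma> \<tau> \<longleftrightarrow> (\<exists>\<upsilon> \<in> conds n. elems \<upsilon> = elems \<sigma> \<union> elems \<tau>)"

definition entry :: "'a \<Rightarrow> 'a \<Rightarrow> 'a \<Rightarrow> 'a" where
  "entry A a b = app A (pair a b)"

definition wphp_array :: "'a \<Rightarrow> 'a \<Rightarrow> 'a \<Rightarrow> 'a \<Rightarrow> 'a \<Rightarrow> bool" where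
  "wphp_array n m k \<sigma> A \<longleftrightarrow>
     fun_on A {pair a b | a b. a \<in> seg (two \<otimes> m) \<and> b \<in> seg m} \<and>
     (\<forall>a \<in> seg (two \<otimes> m). \<forall>b \<in> seg m. \<forall>\<tau> \<in> elems (entry A a b).
        \<tau> \<in> conds n \<and> mcard \<tau> \<preceq> k \<and> compatible n \<tau> \<sigma> \<and> elems \<tau> \<inter> elems \<sigma> = {}) \<and>
     (\<forall>a \<in> seg (two \<otimes> m). \<forall>a' \<in> seg (two \<otimes> m). \<forall>b \<in> seg m.
        a \<noteq> a' \<longrightarrow> elems (entry A a b) \<inter> elems (entry A a' b) = {}) \<and>
     (\<forall>a \<in> seg (two \<otimes> m). \<forall>b \<in> seg m. \<forall>b' \<in> seg m.
        b \<noteq> b' \<longrightarrow> elems (entry A a b) \<inter> elems (entry A a b') = {}) \<and>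
     (\<forall>a \<in> seg (two \<otimes> m). \<forall>a' \<in> seg (two \<otimes> m). \<forall>b \<in> seg m.
        \<forall>\<tau> \<in> elems (entry A a b). \<forall>\<tau>' \<in> elems (entry A a' b).
          \<tau> \<noteq> \<tau>' \<longrightarrow> \<not> compatible n \<tau> \<tau>') \<and>
     (\<forall>a \<in> seg (two \<otimes> m). \<forall>b \<in> seg m. \<forall>b' \<in> seg m.
        \<forall>\<tau> \<in> elems (entry A a b). \<forall>\<tau>' \<in> elems (entry A a b').
          \<tau> \<noteq> \<tau>' \<longrightarrow> \<not> compatible n \<tau> \<tau>') \<and>
     (\<forall>\<rho> \<in> conds n. extends \<rho> \<sigma> \<longrightarrow>
        (\<forall>a \<in> seg (two \<otimes> m). \<exists>b \<in> seg m. \<exists>\<tau> \<in> elems (entry A a b). compatible n \<tau> \<rho>))"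

definition uniform :: "'a \<Rightarrow> 'a \<Rightarrow> 'a \<Rightarrow> bool" where
  "uniform m k A \<longleftrightarrow>
     (\<forall>a \<in> seg (two \<otimes> m). \<forall>b \<in> seg m. \<forall>\<tau> \<in> elems (entry A a b). mcard \<tau> = k)"

definition array_size :: "'a \<Rightarrow> 'a \<Rightarrow> 'a" where
  "array_size m A = msum (two \<otimes> m) (\<lambda>a. msum m (\<lambda>b. mcard (entry A a b)))"

end

notation le ("(_ \<preceq>\<index> _)" [51, 51] 50)
notation diff (infixl "\<ominus>\<index>" 65)

end

theory Submission
  imports Defs "HOL-Library.FuncSet" "HOL-Library.Nat_Bijection"
begin

text \<open>
  By condition (2) the entries of a column are pairwise incompatible matchings of size \<open>k\<close>
  between the \<open>N = n + 1 - |\<sigma>|\<close> domain points and the \<open>N - 1\<close> range points not used by \<open>\<sigma>\<close>. Among the \<open>N!\<close> injections from the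
  latter to the former, \<open>(N - k)!\<close> extend a given \<open>k\<close>-matching, and none extends two incompatible
  ones; so a column contains at most \<open>N! / (N - k)!\<close> conditions. This is carried out in the
  natural numbers and transferred to \<open>M\<close>: apart from the bounds with a standard exponent, which
  are eliminated inside \<open>M\<close>, the assertion is a first-order sentence. Instead of writing down
  formulas, we show that the predicates involved are defined in \<open>M\<close> and in the natural numbers by
  one and the same formula.
\<close>

section \<open>Simultaneous definability in two structures\<close>

text \<open>The shape of the bound comes from the direction of the injections. There is one free
  domain point more than there are free range points, so nothing injects the former into the latter.
  In the other direction there are N!/1! injections, and after k values have been fixed the two
  remainders still differ by one, which leaves (N - k)!/1! of them.

  Two obstacles shape the transfer. Condition (4) quantifies over \<open>conds\<close>, which
  involves a standard exponent. It is therefore applied inside the model, where it yields some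
  condition in the array; this single condition shows k \<le> N, without which the iterated
  subtraction in the bound would have no meaning. Moreover, sums and factorials of the model are
  values of recursions along coded sequences. For an arbitrary step function such a sequence need
  not exist, so definability of the step functions has to be carried through both nested
  sums.\<close>

lemma finite_tm_vars [simp]: "finite (tm_vars t)"
  by (induction t) auto

lemma finite_free_vars [simp]: "finite (free_vars p)"
  by (induction p) auto

lemma tm_val_cong: "(\<And>i. i \<in> tm_vars t \<Longrightarrow> e i = e' i) \<Longrightarrow> tm_val M e t = tm_val M e' t"
  by (induction t) auto

lemma sat_cong: "(\<And>i. i \<in> free_vars p \<Longrightarrow> e i = e' i) \<Longrightarrow> sat M e p = sat M e' p"
proof (induction p arbitrary: e e')
  case (Equal s t)
  then show ?case using tm_val_cong[of s e e'] tm_val_cong[of t e e'] by auto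
next
  case (Less s t)
  then show ?case using tm_val_cong[of s e e'] tm_val_cong[of t e e'] by auto
next
  case (Neg p)
  from Neg.IH[of e e'] Neg.prems show ?case by simp
next
  case (Conj p q)
  from Conj.IH(1)[of e e'] Conj.IH(2)[of e e'] Conj.prems show ?case by auto
next
  case (Forall i p)
  have "sat M (e(i := x)) p = sat M (e'(i := x)) p" for x
    by (rule Forall.IH) (use Forall.prems in auto)
  then show ?case by simp
qed

primrec tm_rename :: "(nat \<Rightarrow> nat) \<Rightarrow> tm \<Rightarrow> tm" where
  "tm_rename f (Var i) = Var (f i)"
| "tm_rename f Zero = Zero"
| "tm_rename f One = One"
| "tm_rename f (Half t) = Half (tm_rename f t)"
| "tm_rename f (Len t) = Len (tm_rename f t)"
| "tm_rename f (Add s t) = Add (tm_rename f s) (tm_rename f t)"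
| "tm_rename f (Mul s t) = Mul (tm_rename f s) (tm_rename f t)"
| "tm_rename f (Smash s t) = Smash (tm_rename f s) (tm_rename f t)"

lemma tm_val_rename [simp]: "tm_val M e (tm_rename f t) = tm_val M (\<lambda>n. e (f n)) t"
  by (induction t) auto

lemma obtain_fresh:
  fixes S :: "nat set"
  assumes "finite S"
  obtains j where "j \<notin> S"
  using assms ex_new_if_finite by blast

text \<open>The map \<open>f\<close> may identify variables or move one under a binder for it, so a
  bound variable is replaced by a \<open>j\<close> outside the image of the free variables.
  Existence is stated rather than a renaming function, which leaves the choice of \<open>j\<close>
  open; one \<open>q\<close> must serve both structures.\<close>

lemma ex_rename:
  "\<exists>q. (\<forall>e. sat M e q = sat M (\<lambda>n. e (f n)) p) \<and> (\<forall>e. sat N e q = sat N (\<lambda>n. e (f n)) p)"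
proof (induction p arbitrary: f)
  case (Equal s t)
  show ?case by (rule exI[of _ "Equal (tm_rename f s) (tm_rename f t)"]) simp
next
  case (Less s t)
  show ?case by (rule exI[of _ "Less (tm_rename f s) (tm_rename f t)"]) simp
next
  case (Neg p)
  from Neg[of f] obtain q where "\<forall>e. sat M e q = sat M (\<lambda>n. e (f n)) p"
    "\<forall>e. sat N e q = sat N (\<lambda>n. e (f n)) p" by blast
  then show ?case by (intro exI[of _ "Neg q"]) simp
next
  case (Conj p1 p2)
  from Conj(1)[of f] obtain q1 where "\<forall>e. sat M e q1 = sat M (\<lambda>n. e (f n)) p1"
    "\<forall>e. sat N e q1 = sat N (\<lambda>n. e (f n)) p1" by blast
  moreover from Conj(2)[of f] obtain q2 where "\<forall>e. sat M e q2 = sat M (\<lambda>n. e (f n)) p2"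
    "\<forall>e. sat N e q2 = sat N (\<lambda>n. e (f n)) p2" by blast
  ultimately show ?case by (intro exI[of _ "Conj q1 q2"]) simp
next
  case (Forall i p)
  obtain j where j: "j \<notin> f ` free_vars p" by (rule obtain_fresh[of "f ` free_vars p"]) auto
  from Forall[of "f(i := j)"] obtain q
    where qM: "\<forall>e. sat M e q = sat M (\<lambda>n. e ((f(i := j)) n)) p"
      and qN: "\<forall>e. sat N e q = sat N (\<lambda>n. e ((f(i := j)) n)) p" by blast
  have *: "sat K (\<lambda>n. (e(j := x)) ((f(i := j)) n)) p = sat K ((\<lambda>n. e (f n))(i := x)) p"
    for K :: "'c arith" and e x
    by (rule sat_cong) (use j in auto)
  show ?case
    by (intro exI[of _ "Forall j q"] conjI allI; unfold sat.simps; subst qM qN; subst *; rule refl)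
qed

text \<open>
  Environments are used in de Bruijn style: entering the scope of a quantifier shifts the
  environment by one, and the new variable becomes number 0.
\<close>

definition definable ::
    "'a arith \<Rightarrow> 'b arith \<Rightarrow> ((nat \<Rightarrow> 'a) \<Rightarrow> bool) \<Rightarrow> ((nat \<Rightarrow> 'b) \<Rightarrow> bool) \<Rightarrow> bool" where
  "definable M N P P' \<longleftrightarrow> (\<exists>p. (\<forall>e. sat M e p = P e) \<and> (\<forall>e. sat N e p = P' e))"

text \<open>Cardinalities, sums and factorials are not terms of the language. Working with graphs
  still allows them to be nested like terms, by means of \<open>definable_subst\<close>.\<close>

definition definable_fun ::
    "'a arith \<Rightarrow> 'b arith \<Rightarrow> ((nat \<Rightarrow> 'a) \<Rightarrow> 'a) \<Rightarrow> ((nat \<Rightarrow> 'b) \<Rightarrow> 'b) \<Rightarrow> bool" where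
  "definable_fun M N f f' \<longleftrightarrow>
     definable M N (\<lambda>e. e 0 = f (\<lambda>n. e (Suc n))) (\<lambda>e. e 0 = f' (\<lambda>n. e (Suc n)))"

lemma definableI: "(\<And>e. sat M e p = P e) \<Longrightarrow> (\<And>e. sat N e p = P' e) \<Longrightarrow> definable M N P P'"
  unfolding definable_def by blast

lemma definable_rename:
  assumes "definable M N P P'"
  shows "definable M N (\<lambda>e. P (\<lambda>n. e (f n))) (\<lambda>e. P' (\<lambda>n. e (f n)))"
proof -
  from assms obtain p where "\<forall>e. sat M e p = P e" "\<forall>e. sat N e p = P' e"
    unfolding definable_def by blast
  with ex_rename[of M f p N] show ?thesis unfolding definable_def by auto
qed

lemma definable_not:
  assumes "definable M N P P'"
  shows "definable M N (\<lambda>e. \<not> P e) (\<lambda>e. \<not> P' e)"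
proof -
  from assms obtain p where "\<And>e. sat M e p = P e" "\<And>e. sat N e p = P' e"
    unfolding definable_def by blast
  then show ?thesis by (intro definableI[where p = "Neg p"]) auto
qed

lemma definable_conj:
  assumes "definable M N P P'" and "definable M N Q Q'"
  shows "definable M N (\<lambda>e. P e \<and> Q e) (\<lambda>e. P' e \<and> Q' e)"
proof -
  from assms obtain p q where "\<And>e. sat M e p = P e" "\<And>e. sat N e p = P' e"
    "\<And>e. sat M e q = Q e" "\<And>e. sat N e q = Q' e"
    unfolding definable_def by blast
  then show ?thesis by (intro definableI[where p = "Conj p q"]) auto
qed

lemma definable_disj:
  assumes "definable M N P P'" and "definable M N Q Q'"
  shows "definable M N (\<lambda>e. P e \<or> Q e) (\<lambda>e. P' e \<or> Q' e)"
  using definable_not[OF definable_conj[OF definable_not definable_not, OF assms]] by simp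

lemma definable_imp:
  assumes "definable M N P P'" and "definable M N Q Q'"
  shows "definable M N (\<lambda>e. P e \<longrightarrow> Q e) (\<lambda>e. P' e \<longrightarrow> Q' e)"
  using definable_not[OF definable_conj[OF assms(1) definable_not, OF assms(2)]] by simp

lemma definable_iff:
  assumes "definable M N P P'" and "definable M N Q Q'"
  shows "definable M N (\<lambda>e. P e \<longleftrightarrow> Q e) (\<lambda>e. P' e \<longleftrightarrow> Q' e)"
  using definable_conj[OF definable_imp[OF assms] definable_imp[OF assms(2,1)]]
  by (simp add: iff_conv_conj_imp)

text \<open>Formulas have named variables, so the de Bruijn quantifier becomes
  \<open>Forall j\<close> after renaming 0 to \<open>j\<close> and \<open>Suc n\<close> to
  \<open>n\<close>. Since the other free variables move down by one, \<open>j\<close> has to avoid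
  the predecessors of the free variables of \<open>p\<close>.\<close>

lemma definable_all:
  assumes "definable M N (\<lambda>e. Q (e 0) (\<lambda>n. e (Suc n))) (\<lambda>e. Q' (e 0) (\<lambda>n. e (Suc n)))"
  shows "definable M N (\<lambda>e. \<forall>y. Q y e) (\<lambda>e. \<forall>y. Q' y e)"
proof -
  from assms obtain p where p: "\<And>e. sat M e p = Q (e 0) (\<lambda>n. e (Suc n))"
    "\<And>e. sat N e p = Q' (e 0) (\<lambda>n. e (Suc n))"
    unfolding definable_def by blast
  obtain j where j: "j \<notin> (\<lambda>i. i - 1) ` free_vars p"
    by (rule obtain_fresh[of "(\<lambda>i. i - 1) ` free_vars p"]) auto
  define f where "f = case_nat j (\<lambda>n. n)"
  from ex_rename[of M f p N] obtain q where q: "\<And>e. sat M e q = sat M (\<lambda>n. e (f n)) p"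
    "\<And>e. sat N e q = sat N (\<lambda>n. e (f n)) p" by blast
  have *: "sat K (\<lambda>n. (e(j := y)) (f n)) p = sat K (case_nat y e) p" for K :: "'c arith" and e y
    by (rule sat_cong) (use j in \<open>force simp: f_def split: nat.split\<close>)
  show ?thesis
    by (rule definableI[where p = "Forall j q"]; unfold sat.simps q *; simp add: p)
qed

lemma definable_ex:
  assumes "definable M N (\<lambda>e. Q (e 0) (\<lambda>n. e (Suc n))) (\<lambda>e. Q' (e 0) (\<lambda>n. e (Suc n)))"
  shows "definable M N (\<lambda>e. \<exists>y. Q y e) (\<lambda>e. \<exists>y. Q' y e)"
  using definable_not[OF definable_all[where Q = "\<lambda>y e. \<not> Q y e" and Q' = "\<lambda>y e. \<not> Q' y e",
        OF definable_not[OF assms]]] by simp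

lemma definable_fun_rename:
  assumes "definable_fun M N x x'"
  shows "definable_fun M N (\<lambda>e. x (\<lambda>n. e (f n))) (\<lambda>e. x' (\<lambda>n. e (f n)))"
  using definable_rename[OF assms[unfolded definable_fun_def], of "case_nat 0 (\<lambda>n. Suc (f n))"]
  unfolding definable_fun_def by simp

text \<open>In place of a term for \<open>x e\<close>, an existential quantifier names the value. No
  existence or uniqueness proof arises, as \<open>x\<close> is a total function outside the
  formula.\<close>

lemma definable_subst:
  assumes "definable_fun M N x x'"
    and "definable M N (\<lambda>e. P (e 0) (\<lambda>n. e (Suc n))) (\<lambda>e. P' (e 0) (\<lambda>n. e (Suc n)))"
  shows "definable M N (\<lambda>e. P (x e) e) (\<lambda>e. P' (x' e) e)"
proof -
  have "definable M N (\<lambda>e. \<exists>y. y = x e \<and> P y e) (\<lambda>e. \<exists>y. y = x' e \<and> P' y e)"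
    by (rule definable_ex, rule definable_conj)
      (use assms in \<open>simp_all add: definable_fun_def\<close>)
  then show ?thesis by simp
qed

lemma definable_subst2:
  assumes "definable_fun M N x x'" and y: "definable_fun M N y y'"
    and P: "definable M N (\<lambda>e. P (e (Suc 0)) (e 0) (\<lambda>n. e (Suc (Suc n))))
      (\<lambda>e. P' (e (Suc 0)) (e 0) (\<lambda>n. e (Suc (Suc n))))"
  shows "definable M N (\<lambda>e. P (x e) (y e) e) (\<lambda>e. P' (x' e) (y' e) e)"
  by (rule definable_subst[OF assms(1), where P = "\<lambda>u e. P u (y e) e" and P' = "\<lambda>u e. P' u (y' e) e"])
    (rule definable_subst[OF definable_fun_rename[OF y],
        where P = "\<lambda>v e. P (e 0) v (\<lambda>n. e (Suc n))" and P' = "\<lambda>v e. P' (e 0) v (\<lambda>n. e (Suc n))"],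
      rule P)

lemma definable_eq:
  assumes "definable_fun M N x x'" and "definable_fun M N y y'"
  shows "definable M N (\<lambda>e. x e = y e) (\<lambda>e. x' e = y' e)"
  by (rule definable_subst2[OF assms, where P = "\<lambda>u v e. u = v" and P' = "\<lambda>u v e. u = v"],
      rule definableI[where p = "Equal (Var (Suc 0)) (Var 0)"]) simp_all

lemma definable_less:
  assumes "definable_fun M N x x'" and "definable_fun M N y y'"
  shows "definable M N (\<lambda>e. less M (x e) (y e)) (\<lambda>e. less N (x' e) (y' e))"
  by (rule definable_subst2[OF assms, where P = "\<lambda>u v e. less M u v" and P' = "\<lambda>u v e. less N u v"],
      rule definableI[where p = "Less (Var (Suc 0)) (Var 0)"]) simp_all

lemma definable_var: "definable_fun M N (\<lambda>e. e i) (\<lambda>e. e i)"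
  unfolding definable_fun_def
  by (rule definableI[where p = "Equal (Var 0) (Var (Suc i))"]) simp_all

lemma definable_zero: "definable_fun M N (\<lambda>e. zero M) (\<lambda>e. zero N)"
  unfolding definable_fun_def by (rule definableI[where p = "Equal (Var 0) Zero"]) simp_all

lemma definable_one: "definable_fun M N (\<lambda>e. one M) (\<lambda>e. one N)"
  unfolding definable_fun_def by (rule definableI[where p = "Equal (Var 0) One"]) simp_all

lemma definable_half:
  assumes "definable_fun M N x x'"
  shows "definable_fun M N (\<lambda>e. half M (x e)) (\<lambda>e. half N (x' e))"
  unfolding definable_fun_def
  by (rule definable_subst[OF definable_fun_rename[OF assms], where P = "\<lambda>u e. e 0 = half M u"
        and P' = "\<lambda>u e. e 0 = half N u"],
      rule definableI[where p = "Equal (Var (Suc 0)) (Half (Var 0))"]) simp_all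

lemma definable_len:
  assumes "definable_fun M N x x'"
  shows "definable_fun M N (\<lambda>e. len M (x e)) (\<lambda>e. len N (x' e))"
  unfolding definable_fun_def
  by (rule definable_subst[OF definable_fun_rename[OF assms], where P = "\<lambda>u e. e 0 = len M u"
        and P' = "\<lambda>u e. e 0 = len N u"],
      rule definableI[where p = "Equal (Var (Suc 0)) (Len (Var 0))"]) simp_all

lemma definable_add:
  assumes "definable_fun M N x x'" and "definable_fun M N y y'"
  shows "definable_fun M N (\<lambda>e. add M (x e) (y e)) (\<lambda>e. add N (x' e) (y' e))"
  unfolding definable_fun_def
  by (rule definable_subst2[OF definable_fun_rename definable_fun_rename, OF assms,
        where P = "\<lambda>u v e. e 0 = add M u v" and P' = "\<lambda>u v e. e 0 = add N u v"],
      rule definableI[where p = "Equal (Var (Suc (Suc 0))) (Add (Var (Suc 0)) (Var 0))"]) simp_all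

lemma definable_mul:
  assumes "definable_fun M N x x'" and "definable_fun M N y y'"
  shows "definable_fun M N (\<lambda>e. mul M (x e) (y e)) (\<lambda>e. mul N (x' e) (y' e))"
  unfolding definable_fun_def
  by (rule definable_subst2[OF definable_fun_rename definable_fun_rename, OF assms,
        where P = "\<lambda>u v e. e 0 = mul M u v" and P' = "\<lambda>u v e. e 0 = mul N u v"],
      rule definableI[where p = "Equal (Var (Suc (Suc 0))) (Mul (Var (Suc 0)) (Var 0))"]) simp_all

lemma definable_smash:
  assumes "definable_fun M N x x'" and "definable_fun M N y y'"
  shows "definable_fun M N (\<lambda>e. smash M (x e) (y e)) (\<lambda>e. smash N (x' e) (y' e))"
  unfolding definable_fun_def
  by (rule definable_subst2[OF definable_fun_rename definable_fun_rename, OF assms,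
        where P = "\<lambda>u v e. e 0 = smash M u v" and P' = "\<lambda>u v e. e 0 = smash N u v"],
      rule definableI[where p = "Equal (Var (Suc (Suc 0))) (Smash (Var (Suc 0)) (Var 0))"]) simp_all

text \<open>Made for the step function of a recursion: it is applied to an index and a sequence
  value below further quantifiers, so its remaining parameters are shifted by some
  \<open>f\<close>.\<close>

lemma definable_fun_subst2:
  assumes "definable_fun M N x x'" and "definable_fun M N y y'"
    and G: "definable_fun M N (\<lambda>e. G (e (Suc 0)) (e 0) (\<lambda>n. e (Suc (Suc n))))
      (\<lambda>e. G' (e (Suc 0)) (e 0) (\<lambda>n. e (Suc (Suc n))))"
  shows "definable_fun M N (\<lambda>e. G (x e) (y e) (\<lambda>n. e (f n))) (\<lambda>e. G' (x' e) (y' e) (\<lambda>n. e (f n)))"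
  unfolding definable_fun_def
proof (rule definable_subst2[OF definable_fun_rename definable_fun_rename, OF assms(1,2),
        where P = "\<lambda>u v e. e 0 = G u v (\<lambda>n. e (Suc (f n)))"
        and P' = "\<lambda>u v e. e 0 = G' u v (\<lambda>n. e (Suc (f n)))"])
  show "definable M N
     (\<lambda>e. e (Suc (Suc 0)) = G (e (Suc 0)) (e 0) (\<lambda>n. e (Suc (Suc (Suc (f n))))))
     (\<lambda>e. e (Suc (Suc 0)) = G' (e (Suc 0)) (e 0) (\<lambda>n. e (Suc (Suc (Suc (f n))))))"
    using definable_rename[OF G[unfolded definable_fun_def],
        of "case_nat (Suc (Suc 0)) (case_nat 0 (case_nat (Suc 0) (\<lambda>n. Suc (Suc (Suc (f n))))))"]
    by simp
qed

section \<open>Universal closure and transfer from the natural numbers\<close>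

lemma sat_foldr_ForallI: "(\<And>e. sat M e p) \<Longrightarrow> sat M e (foldr Forall xs p)"
  by (induction xs arbitrary: e) auto

lemma sat_foldr_ForallD: "sat M e (foldr Forall xs p) \<Longrightarrow> sat M e p"
proof (induction xs)
  case (Cons i xs)
  then have "sat M (e(i := e i)) (foldr Forall xs p)" unfolding foldr.simps o_apply sat.simps by blast
  with Cons.IH show ?case by simp
qed simp

lemma free_vars_foldr_Forall: "free_vars (foldr Forall xs p) = free_vars p - set xs"
  by (induction xs) auto

text \<open>True arithmetic contains sentences only, so the defining formula is closed over its free
  variables. Instantiating the closure with the values of \<open>e\<close> itself gives back the
  open formula.\<close>

lemma transfer_nat:
  assumes "\<forall>p \<in> true_arithmetic. models M p"
    and "definable M nat_arith P P'" and "\<And>e. P' e"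
  shows "P e"
proof -
  from assms(2) obtain p where p: "\<And>e. sat M e p = P e" "\<And>e. sat nat_arith e p = P' e"
    unfolding definable_def by blast
  obtain xs where xs: "set xs = free_vars p" using finite_list[of "free_vars p"] by auto
  let ?q = "foldr Forall xs p"
  have "?q \<in> true_arithmetic"
    unfolding true_arithmetic_def models_def
    by (auto simp: free_vars_foldr_Forall xs p assms(3) intro!: sat_foldr_ForallI)
  with assms(1) have "sat M e ?q" unfolding models_def by blast
  then show ?thesis using sat_foldr_ForallD p by blast
qed

section \<open>Definite descriptions with a default value\<close>

definition the0 :: "'a arith \<Rightarrow> ('a \<Rightarrow> bool) \<Rightarrow> 'a" where
  "the0 M P = (if \<exists>!x. P x then THE x. P x else zero M)"

lemma the0_eq_The: "\<exists>!x. P x \<Longrightarrow> the0 M P = (THE x. P x)"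
  by (simp add: the0_def)

lemma the0_equality:
  assumes "P y" and "\<And>z. P z \<Longrightarrow> z = y"
  shows "the0 M P = y"
proof -
  have "\<exists>!x. P x" using assms by blast
  with the_equality[of P y, OF assms] show ?thesis by (simp add: the0_def)
qed

text \<open>The right-hand side is built from \<open>P\<close>, quantifiers, equality and the
  constant zero, so it is a formula whenever \<open>P\<close> is one. The value of
  \<open>THE\<close> without unique existence admits no such description.\<close>

lemma the0_graph:
  "y = the0 M P \<longleftrightarrow> (P y \<and> (\<forall>z. P z \<longrightarrow> z = y)) \<or> (\<not> (\<exists>x. P x \<and> (\<forall>z. P z \<longrightarrow> z = x)) \<and> y = zero M)"
proof (cases "\<exists>!x. P x")
  case True
  then have "P (THE x. P x)" by (rule theI')
  with True show ?thesis unfolding the0_def by (simp only: if_True) metis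
next
  case False
  then show ?thesis unfolding the0_def by (simp only: if_False) blast
qed

lemma definable_the0:
  assumes "definable M N (\<lambda>e. P (e 0) (\<lambda>n. e (Suc n))) (\<lambda>e. P' (e 0) (\<lambda>n. e (Suc n)))"
  shows "definable_fun M N (\<lambda>e. the0 M (\<lambda>y. P y e)) (\<lambda>e. the0 N (\<lambda>y. P' y e))"
proof -
  \<comment> \<open>\<open>P\<close> occurs below different numbers of quantifiers, so the
    assumption is first freed from its fixed variable and shift.\<close>
  have P: "definable M N (\<lambda>e. P (e i) (\<lambda>n. e (f n))) (\<lambda>e. P' (e i) (\<lambda>n. e (f n)))" for i f
    using definable_rename[OF assms, of "case_nat i f"] by simp
  show ?thesis
    unfolding definable_fun_def the0_graph
    by (intro P definable_not definable_conj definable_disj definable_imp definable_all definable_ex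
        definable_eq definable_var definable_zero)
qed

section \<open>Definability of the coded notions\<close>

lemma definable_two: "definable_fun M N (\<lambda>e. two M) (\<lambda>e. two N)"
  unfolding two_def by (intro definable_add definable_one)

lemma definable_pair:
  assumes "definable_fun M N x x'" and "definable_fun M N y y'"
  shows "definable_fun M N (\<lambda>e. pair M (x e) (y e)) (\<lambda>e. pair N (x' e) (y' e))"
  unfolding pair_def by (intro definable_half definable_add definable_mul definable_one assms)

lemmas definable_logic = definable_not definable_conj definable_disj definable_imp definable_iff
  definable_all definable_ex

lemmas definable_arith = definable_eq definable_less definable_var definable_zero definable_one
  definable_half definable_len definable_add definable_mul definable_smash definable_two
  definable_pair

lemma definable_le:
  assumes "definable_fun M N x x'" and "definable_fun M N y y'"
  shows "definable M N (\<lambda>e. le M (x e) (y e)) (\<lambda>e. le N (x' e) (y' e))"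
  unfolding le_def by (intro definable_logic definable_arith assms)

lemma definable_elems:
  assumes "definable_fun M N x x'" and "definable_fun M N s s'"
  shows "definable M N (\<lambda>e. x e \<in> elems M (s e)) (\<lambda>e. x' e \<in> elems N (s' e))"
  unfolding elems_def mem_Collect_eq
  by (intro definable_logic definable_arith assms[THEN definable_fun_rename])

lemma definable_fun_on:
  assumes f: "definable_fun M N f f'"
    and D: "definable M N (\<lambda>e. e 0 \<in> D (\<lambda>n. e (Suc n))) (\<lambda>e. e 0 \<in> D' (\<lambda>n. e (Suc n)))"
  shows "definable M N (\<lambda>e. fun_on M (f e) (D e)) (\<lambda>e. fun_on N (f' e) (D' e))"
proof -
  have D: "definable M N (\<lambda>e. e i \<in> D (\<lambda>n. e (g n))) (\<lambda>e. e i \<in> D' (\<lambda>n. e (g n)))" for i g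
    using definable_rename[OF D, of "case_nat i g"] by simp
  show ?thesis
    unfolding fun_on_def Ball_def Ex1_def
    by (intro D definable_logic definable_arith definable_elems f[THEN definable_fun_rename])
qed

lemma definable_partial_injection:
  assumes "definable_fun M N n n'" and "definable_fun M N s s'"
  shows "definable M N (\<lambda>e. partial_injection M (n e) (s e)) (\<lambda>e. partial_injection N (n' e) (s' e))"
  unfolding partial_injection_def seg_def Ball_def mem_Collect_eq
  by (intro definable_logic definable_arith definable_elems assms[THEN definable_fun_rename])

text \<open>
  Counterparts of the notions defined by \<open>THE\<close>, with value \<open>zero M\<close> instead of an unspecified
  element where there is no unique choice: unlike the originals they are definable everywhere.
\<close>

definition diff0 :: "'a arith \<Rightarrow> 'a \<Rightarrow> 'a \<Rightarrow> 'a" where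
  "diff0 M x y = the0 M (\<lambda>z. add M y z = x)"

definition quot0 :: "'a arith \<Rightarrow> 'a \<Rightarrow> 'a \<Rightarrow> 'a" where
  "quot0 M x y = the0 M (\<lambda>q. \<exists>r. less M r y \<and> x = add M (mul M q y) r)"

definition app0 :: "'a arith \<Rightarrow> 'a \<Rightarrow> 'a \<Rightarrow> 'a" where
  "app0 M f x = the0 M (\<lambda>y. pair M x y \<in> elems M f)"

definition counts :: "'a arith \<Rightarrow> 'a \<Rightarrow> 'a \<Rightarrow> bool" where
  "counts M s c \<longleftrightarrow> (\<exists>f. fun_on M f (elems M s) \<and> bij_betw (app0 M f) (elems M s) (seg M c))"

definition mcard0 :: "'a arith \<Rightarrow> 'a \<Rightarrow> 'a" where
  "mcard0 M s = the0 M (counts M s)"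

definition iterates :: "'a arith \<Rightarrow> 'a \<Rightarrow> ('a \<Rightarrow> 'a \<Rightarrow> 'a) \<Rightarrow> 'a \<Rightarrow> 'a \<Rightarrow> bool" where
  "iterates M a g l y \<longleftrightarrow> (\<exists>p. fun_on M p (seg M (add M l (one M))) \<and> app0 M p (zero M) = a \<and>
     (\<forall>i. less M i l \<longrightarrow> app0 M p (add M i (one M)) = g i (app0 M p i)) \<and> app0 M p l = y)"

definition iter0 :: "'a arith \<Rightarrow> 'a \<Rightarrow> ('a \<Rightarrow> 'a \<Rightarrow> 'a) \<Rightarrow> 'a \<Rightarrow> 'a" where
  "iter0 M a g l = the0 M (iterates M a g l)"

definition msum0 :: "'a arith \<Rightarrow> 'a \<Rightarrow> ('a \<Rightarrow> 'a) \<Rightarrow> 'a" where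
  "msum0 M l f = iter0 M (zero M) (\<lambda>i s. add M s (f i)) l"

definition mfact0 :: "'a arith \<Rightarrow> 'a \<Rightarrow> 'a" where
  "mfact0 M l = iter0 M (one M) (\<lambda>i y. mul M y (add M i (one M))) l"

definition entry0 :: "'a arith \<Rightarrow> 'a \<Rightarrow> 'a \<Rightarrow> 'a \<Rightarrow> 'a" where
  "entry0 M A a b = app0 M A (pair M a b)"

definition array_size0 :: "'a arith \<Rightarrow> 'a \<Rightarrow> 'a \<Rightarrow> 'a" where
  "array_size0 M m A =
     msum0 M (mul M (two M) m) (\<lambda>a. msum0 M m (\<lambda>b. mcard0 M (entry0 M A a b)))"

lemma definable_diff0:
  assumes "definable_fun M N x x'" and "definable_fun M N y y'"
  shows "definable_fun M N (\<lambda>e. diff0 M (x e) (y e)) (\<lambda>e. diff0 N (x' e) (y' e))"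
  unfolding diff0_def
  by (intro definable_the0 definable_logic definable_arith assms[THEN definable_fun_rename])

lemma definable_quot0:
  assumes "definable_fun M N x x'" and "definable_fun M N y y'"
  shows "definable_fun M N (\<lambda>e. quot0 M (x e) (y e)) (\<lambda>e. quot0 N (x' e) (y' e))"
  unfolding quot0_def
  by (intro definable_the0 definable_logic definable_arith assms[THEN definable_fun_rename])

lemma definable_app0:
  assumes "definable_fun M N f f'" and "definable_fun M N x x'"
  shows "definable_fun M N (\<lambda>e. app0 M (f e) (x e)) (\<lambda>e. app0 N (f' e) (x' e))"
  unfolding app0_def
  by (intro definable_the0 definable_logic definable_arith definable_elems
      assms[THEN definable_fun_rename])

lemma definable_counts:
  assumes "definable_fun M N s s'" and "definable_fun M N c c'"
  shows "definable M N (\<lambda>e. counts M (s e) (c e)) (\<lambda>e. counts N (s' e) (c' e))"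
  unfolding counts_def bij_betw_def inj_on_def set_eq_iff image_iff seg_def Ball_def Bex_def
    mem_Collect_eq
  by (intro definable_logic definable_arith definable_elems definable_fun_on definable_app0
      assms[THEN definable_fun_rename])

lemma definable_mcard0:
  assumes "definable_fun M N s s'"
  shows "definable_fun M N (\<lambda>e. mcard0 M (s e)) (\<lambda>e. mcard0 N (s' e))"
  unfolding mcard0_def
  by (intro definable_the0 definable_counts definable_arith assms[THEN definable_fun_rename])

lemma definable_iterates:
  assumes "definable_fun M N a a'" and "definable_fun M N l l'" and "definable_fun M N y y'"
    and g: "definable_fun M N (\<lambda>e. g (e (Suc 0)) (e 0) (\<lambda>n. e (Suc (Suc n))))
      (\<lambda>e. g' (e (Suc 0)) (e 0) (\<lambda>n. e (Suc (Suc n))))"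
  shows "definable M N (\<lambda>e. iterates M (a e) (\<lambda>i s. g i s e) (l e) (y e))
    (\<lambda>e. iterates N (a' e) (\<lambda>i s. g' i s e) (l' e) (y' e))"
  unfolding iterates_def seg_def
  by (intro definable_logic definable_fun_subst2[OF _ _ g] definable_arith definable_fun_on
      definable_app0 assms(1-3)[THEN definable_fun_rename]; unfold mem_Collect_eq)
    (intro definable_arith definable_app0 assms(1-3)[THEN definable_fun_rename])

lemma definable_iter0:
  assumes "definable_fun M N a a'" and "definable_fun M N l l'"
    and g: "definable_fun M N (\<lambda>e. g (e (Suc 0)) (e 0) (\<lambda>n. e (Suc (Suc n))))
      (\<lambda>e. g' (e (Suc 0)) (e 0) (\<lambda>n. e (Suc (Suc n))))"
  shows "definable_fun M N (\<lambda>e. iter0 M (a e) (\<lambda>i s. g i s e) (l e))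
    (\<lambda>e. iter0 N (a' e) (\<lambda>i s. g' i s e) (l' e))"
  unfolding iter0_def
  by (intro definable_the0 definable_iterates definable_arith
      definable_fun_subst2[OF _ _ g] assms(1-2)[THEN definable_fun_rename])

lemma definable_msum0:
  assumes "definable_fun M N l l'"
    and f: "definable_fun M N (\<lambda>e. f (e 0) (\<lambda>n. e (Suc n))) (\<lambda>e. f' (e 0) (\<lambda>n. e (Suc n)))"
  shows "definable_fun M N (\<lambda>e. msum0 M (l e) (\<lambda>i. f i e)) (\<lambda>e. msum0 N (l' e) (\<lambda>i. f' i e))"
proof -
  have f: "definable_fun M N (\<lambda>e. f (e (Suc 0)) (\<lambda>n. e (Suc (Suc n))))
      (\<lambda>e. f' (e (Suc 0)) (\<lambda>n. e (Suc (Suc n))))"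
    using definable_fun_rename[OF f, of Suc] .
  show ?thesis
    unfolding msum0_def by (intro definable_iter0 definable_arith assms(1) f)
qed

lemma definable_mfact0:
  assumes "definable_fun M N l l'"
  shows "definable_fun M N (\<lambda>e. mfact0 M (l e)) (\<lambda>e. mfact0 N (l' e))"
  unfolding mfact0_def by (intro definable_iter0 definable_arith assms)

lemma definable_entry0:
  assumes "definable_fun M N A A'" and "definable_fun M N a a'" and "definable_fun M N b b'"
  shows "definable_fun M N (\<lambda>e. entry0 M (A e) (a e) (b e)) (\<lambda>e. entry0 N (A' e) (a' e) (b' e))"
  unfolding entry0_def by (intro definable_app0 definable_arith assms)

lemma definable_array_size0:
  assumes "definable_fun M N m m'" and "definable_fun M N A A'"
  shows "definable_fun M N (\<lambda>e. array_size0 M (m e) (A e)) (\<lambda>e. array_size0 N (m' e) (A' e))"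
  unfolding array_size0_def
  by (intro definable_msum0 definable_mcard0 definable_entry0 definable_arith
      assms[THEN definable_fun_rename] assms)

lemmas definable_notions = definable_le definable_elems definable_fun_on definable_partial_injection
  definable_diff0 definable_quot0 definable_app0 definable_counts definable_mcard0
  definable_mfact0 definable_entry0 definable_array_size0

section \<open>The two sentences to be transferred\<close>

text \<open>\<open>compatible\<close> freed from the bound with a standard exponent, which no
  formula can express.\<close>

definition compatible0 :: "'a arith \<Rightarrow> 'a \<Rightarrow> 'a \<Rightarrow> 'a \<Rightarrow> bool" where
  "compatible0 M n \<sigma> \<tau> \<longleftrightarrow>
     (\<exists>\<upsilon>. partial_injection M n \<upsilon> \<and> elems M \<upsilon> = elems M \<sigma> \<union> elems M \<tau>)"

definition uniform_columns :: "'a arith \<Rightarrow> 'a \<Rightarrow> 'a \<Rightarrow> 'a \<Rightarrow> 'a \<Rightarrow> 'a \<Rightarrow> bool" where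
  "uniform_columns M n m k \<sigma> A \<longleftrightarrow> partial_injection M n \<sigma> \<and>
     (\<forall>a \<in> seg M (mul M (two M) m). \<forall>b \<in> seg M m. \<forall>\<tau> \<in> elems M (entry0 M A a b).
        partial_injection M n \<tau> \<and> mcard0 M \<tau> = k \<and> compatible0 M n \<tau> \<sigma> \<and>
        elems M \<tau> \<inter> elems M \<sigma> = {}) \<and>
     (\<forall>a \<in> seg M (mul M (two M) m). \<forall>a' \<in> seg M (mul M (two M) m). \<forall>b \<in> seg M m.
        a \<noteq> a' \<longrightarrow> elems M (entry0 M A a b) \<inter> elems M (entry0 M A a' b) = {}) \<and>
     (\<forall>a \<in> seg M (mul M (two M) m). \<forall>a' \<in> seg M (mul M (two M) m). \<forall>b \<in> seg M m.
        \<forall>\<tau> \<in> elems M (entry0 M A a b). \<forall>\<tau>' \<in> elems M (entry0 M A a' b).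
          \<tau> \<noteq> \<tau>' \<longrightarrow> \<not> compatible0 M n \<tau> \<tau>')"

text \<open>The existence of a condition in some entry is what forces \<open>k\<close> to be at most
  N. The first two inequalities of the conclusion are carried along because \<open>diff\<close> and
  \<open>diff0\<close> are known to agree only where the subtraction is meaningful.\<close>

definition size_bound :: "'a arith \<Rightarrow> bool" where
  "size_bound M \<longleftrightarrow> (\<forall>n m k \<sigma> A. uniform_columns M n m k \<sigma> A \<and>
     (\<exists>a \<in> seg M (mul M (two M) m). \<exists>b \<in> seg M m. \<exists>\<tau>. \<tau> \<in> elems M (entry0 M A a b)) \<longrightarrow>
     le M (mcard0 M \<sigma>) (add M n (one M)) \<and> le M k (diff0 M (add M n (one M)) (mcard0 M \<sigma>)) \<and>
     le M (array_size0 M m A)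
       (mul M m (quot0 M (mfact0 M (diff0 M (add M n (one M)) (mcard0 M \<sigma>)))
         (mfact0 M (diff0 M (diff0 M (add M n (one M)) (mcard0 M \<sigma>)) k)))))"

text \<open>The arithmetic needed inside the model, bundled so that one definability argument and
  one transfer suffice. The clause on \<open>add M k k\<close> is for doubling a size bound, the
  unique existence clauses are for removing \<open>THE\<close>.\<close>

definition basic_facts :: "'a arith \<Rightarrow> bool" where
  "basic_facts M \<longleftrightarrow>
     (\<forall>x. less M (zero M) (add M x (one M))) \<and>
     (\<forall>x. less M x (add M x (one M))) \<and>
     (\<forall>x y. less M x y \<longrightarrow> less M x (add M y (one M))) \<and>
     (\<forall>x y. less M x y \<longrightarrow> less M (add M x (one M)) (add M y (one M))) \<and>
     (\<forall>x y z. le M x y \<and> le M y z \<longrightarrow> le M x z) \<and>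
     (\<forall>k p l. le M k p \<and> le M (two M) l \<longrightarrow> le M (add M k k) (mul M p l)) \<and>
     (\<forall>x. x = zero M \<or> x = add M (zero M) (one M) \<or> le M (two M) (len M x)) \<and>
     (\<forall>x. mul M (zero M) x = zero M) \<and>
     (\<forall>x. x \<noteq> zero M \<longrightarrow> less M (zero M) x \<and> less M (zero M) (mul M (two M) x)) \<and>
     (\<forall>A. array_size0 M (zero M) A = zero M) \<and>
     (\<forall>x y. le M y x \<longrightarrow> (\<exists>!z. add M y z = x)) \<and>
     (\<forall>x y. less M (zero M) y \<longrightarrow> (\<exists>!q. \<exists>r. less M r y \<and> x = add M (mul M q y) r)) \<and>
     (\<forall>x. less M (zero M) (mfact0 M x)) \<and>
     (\<forall>s. \<exists>!c. counts M s c) \<and>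
     (\<forall>r s t. elems M t = elems M r \<union> elems M s \<longrightarrow>
       le M (mcard0 M t) (add M (mcard0 M r) (mcard0 M s)))"

lemma definable_size_bound: "definable M N (\<lambda>e. size_bound M) (\<lambda>e. size_bound N)"
  unfolding size_bound_def uniform_columns_def compatible0_def Ball_def Bex_def seg_def
    mem_Collect_eq set_eq_iff Int_iff Un_iff empty_iff not_False_eq_True eq_False
  by (intro definable_logic definable_arith definable_notions)

lemma definable_basic_facts: "definable M N (\<lambda>e. basic_facts M) (\<lambda>e. basic_facts N)"
  unfolding basic_facts_def Ex1_def set_eq_iff Un_iff
  by (intro definable_logic definable_arith definable_notions)

section \<open>Incompatible matchings\<close>

lemma card_inj_PiE:
  assumes "finite A" and "card A \<le> card B"
  shows "card {f \<in> A \<rightarrow>\<^sub>E B. inj_on f A} * fact (card B - card A) = fact (card B)"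
proof -
  have "prod ((-) c) {0..<a} * fact (c - a) = (fact c :: nat)" if "a \<le> c" for a c :: nat
    using that
  proof (induction a)
    case (Suc a)
    then have "c - a = Suc (c - Suc a)" by simp
    then have "(fact (c - a) :: nat) = (c - a) * fact (c - Suc a)" by (metis fact_Suc of_nat_id)
    with Suc show ?case by simp
  qed simp
  \<comment> \<open>An infinite \<open>B\<close> has cardinality 0, so that \<open>A\<close> is
    empty and both sides are 1.\<close>
  moreover have "card {f \<in> A \<rightarrow>\<^sub>E B. inj_on f A} = prod ((-) (card B)) {0..<card A}"
    using card_inj_on_subset_funcset[of A B A] assms
    by (cases "finite B") (auto simp: card_eq_0_iff)
  ultimately show ?thesis using assms by simp
qed

definition matching :: "('a \<times> 'b) set \<Rightarrow> bool" where
  "matching T \<longleftrightarrow> single_valued T \<and> single_valued (T\<inverse>)"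

lemma matchingD:
  assumes "matching T"
  shows "(x, y) \<in> T \<Longrightarrow> (x, y') \<in> T \<Longrightarrow> y = y'" and "(x, y) \<in> T \<Longrightarrow> (x', y) \<in> T \<Longrightarrow> x = x'"
  using assms by (auto simp: matching_def single_valued_def)

lemma card_Domain_matching: "matching T \<Longrightarrow> card (Domain T) = card T"
  unfolding Domain_fst by (rule card_image) (auto simp: inj_on_def dest: matchingD)

lemma card_Range_matching: "matching T \<Longrightarrow> card (Range T) = card T"
  unfolding Range_snd by (rule card_image) (auto simp: inj_on_def dest: matchingD)

definition extensions :: "'a set \<Rightarrow> 'b set \<Rightarrow> ('a \<times> 'b) set \<Rightarrow> ('b \<Rightarrow> 'a) set" where
  "extensions X Y T = {g \<in> Y \<rightarrow>\<^sub>E X. inj_on g Y \<and> (\<forall>(x, y) \<in> T. g y = x)}"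

text \<open>The inverse of \<open>T\<close> can be glued to any injection of the remaining range
  points into the remaining domain points. The remainders again differ by one in size, so the number
  of these injections is a full factorial; gluing is injective, which gives the lower bound.\<close>

lemma card_extensions:
  assumes X: "finite X" and Y: "finite Y" and XY: "card X = Suc (card Y)"
    and T: "T \<subseteq> X \<times> Y" "matching T"
  shows "fact (card X - card T) \<le> card (extensions X Y T)"
proof -
  define J where "J = {h \<in> (Y - Range T) \<rightarrow>\<^sub>E (X - Domain T). inj_on h (Y - Range T)}"
  define w where "w y = (THE x. (x, y) \<in> T)" for y
  define F where "F h = (\<lambda>y. if y \<in> Range T then w y else h y)" for h :: "'b \<Rightarrow> 'a"
  have w: "w y = x" if "(x, y) \<in> T" for x y
    unfolding w_def using that matchingD(2)[OF T(2)] by blast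
  have sub: "Domain T \<subseteq> X" "Range T \<subseteq> Y" using T(1) by auto
  have "card T \<le> card Y"
    using card_mono[OF Y sub(2)] card_Range_matching[OF T(2)] by simp
  have "card (X - Domain T) = card X - card T"
    using card_Diff_subset[OF finite_subset[OF sub(1) X] sub(1)] card_Domain_matching[OF T(2)] by simp
  moreover have "card (Y - Range T) = card Y - card T"
    using card_Diff_subset[OF finite_subset[OF sub(2) Y] sub(2)] card_Range_matching[OF T(2)] by simp
  ultimately have "card J = fact (card X - card T)"
    using card_inj_PiE[of "Y - Range T" "X - Domain T"] Y XY \<open>card T \<le> card Y\<close>
    unfolding J_def by simp
  moreover have "card J \<le> card (extensions X Y T)"
  proof (rule card_inj_on_le)
    show "inj_on F J"
    proof (rule inj_onI, rule ext)
      fix h h' y assume h: "h \<in> J" "h' \<in> J" "F h = F h'"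
      show "h y = h' y"
      proof (cases "y \<in> Y - Range T")
        case True
        then show ?thesis using fun_cong[OF h(3), of y] by (simp add: F_def)
      next
        case False
        then show ?thesis using h(1,2) unfolding J_def by (simp add: PiE_def extensional_def)
      qed
    qed
    show "F ` J \<subseteq> extensions X Y T"
    proof
      fix g assume "g \<in> F ` J"
      then obtain h where h: "h \<in> (Y - Range T) \<rightarrow>\<^sub>E (X - Domain T)" "inj_on h (Y - Range T)"
        and g: "g = F h" unfolding J_def by auto
      have hin: "h y \<in> X - Domain T" if "y \<in> Y - Range T" for y using h(1) that by blast
      have gT: "g y = x" if "(x, y) \<in> T" for x y using that w unfolding g F_def by auto
      have gnT: "g y = h y" if "y \<notin> Range T" for y using that unfolding g F_def by simp
      \<comment> \<open>The glued pieces take their values in \<open>Domain T\<close> and in its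
        complement, so they cannot collide.\<close>
      have gD: "g y \<in> Domain T \<longleftrightarrow> y \<in> Range T" if "y \<in> Y" for y
      proof (cases "y \<in> Range T")
        case True
        then obtain x where "(x, y) \<in> T" by blast
        with gT True show ?thesis by blast
      next
        case False
        with gnT hin[of y] that show ?thesis by simp
      qed
      have "g \<in> Y \<rightarrow>\<^sub>E X"
      proof (rule PiE_I)
        fix y assume "y \<in> Y"
        then show "g y \<in> X" using gT gnT hin sub by (cases "y \<in> Range T") auto
      next
        fix y assume "y \<notin> Y"
        with sub(2) have "y \<notin> Range T" by blast
        moreover have "h y = undefined" using h(1) \<open>y \<notin> Y\<close> by (simp add: PiE_def extensional_def)
        ultimately show "g y = undefined" using gnT by simp
      qed
      moreover have "inj_on g Y"
      proof (rule inj_onI)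
        fix y y' assume y: "y \<in> Y" "y' \<in> Y" "g y = g y'"
        show "y = y'"
        proof (cases "y \<in> Range T")
          case True
          then obtain x where x: "(x, y) \<in> T" by blast
          have "y' \<in> Range T" using gD y True by metis
          then obtain x' where "(x', y') \<in> T" by blast
          then show ?thesis using x gT y(3) matchingD(1)[OF T(2)] by metis
        next
          case False
          have "y' \<notin> Range T" using gD y False by metis
          then show ?thesis using False gnT y h(2) by (auto dest: inj_onD)
        qed
      qed
      ultimately show "g \<in> extensions X Y T" unfolding extensions_def using gT by auto
    qed
    show "finite (extensions X Y T)"
      unfolding extensions_def by (rule finite_subset[OF _ finite_PiE[OF Y, of "\<lambda>_. X"]]) (use X in auto)
  qed
  ultimately show ?thesis by simp
qed

lemma card_incompatible_matchings:
  assumes X: "finite X" and Y: "finite Y" and XY: "card X = Suc (card Y)"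
    and F: "\<And>T. T \<in> F \<Longrightarrow> T \<subseteq> X \<times> Y \<and> matching T \<and> card T = k"
    and incomp: "\<And>T T'. T \<in> F \<Longrightarrow> T' \<in> F \<Longrightarrow> T \<noteq> T' \<Longrightarrow> \<not> matching (T \<union> T')"
  shows "card F * fact (card X - k) \<le> fact (card X)"
proof -
  let ?I = "{g \<in> Y \<rightarrow>\<^sub>E X. inj_on g Y}"
  have finF: "finite F"
    by (rule finite_subset[of _ "Pow (X \<times> Y)"]) (use F X Y in auto)
  have finI: "finite ?I"
    by (rule finite_subset[OF _ finite_PiE[OF Y, of "\<lambda>_. X"]]) (use X in auto)
  have sub: "extensions X Y T \<subseteq> ?I" for T unfolding extensions_def by auto
  have disj: "extensions X Y T \<inter> extensions X Y T' = {}"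
    if TT: "T \<in> F" "T' \<in> F" "T \<noteq> T'" for T T'
  proof (rule ccontr)
    assume "extensions X Y T \<inter> extensions X Y T' \<noteq> {}"
    then obtain g where g: "inj_on g Y" "\<And>x y. (x, y) \<in> T \<union> T' \<Longrightarrow> g y = x"
      unfolding extensions_def by blast
    moreover have "\<And>x y. (x, y) \<in> T \<union> T' \<Longrightarrow> y \<in> Y" using F TT by blast
    \<comment> \<open>The union lies in the converse graph of \<open>g\<close>: since
      \<open>g\<close> is a function, each \<open>y\<close> has one partner, and since it is
      injective on \<open>Y\<close>, so has each \<open>x\<close>.\<close>
    ultimately have "matching (T \<union> T')"
      unfolding matching_def single_valued_def by (metis converse_iff inj_onD)
    with incomp TT show False by blast
  qed
  have "card F * fact (card X - k) = (\<Sum>T\<in>F. fact (card X - k))" by simp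
  also have "\<dots> \<le> (\<Sum>T\<in>F. card (extensions X Y T))"
    by (rule sum_mono) (use F card_extensions[OF X Y XY] in blast)
  also have "\<dots> = card (\<Union>T\<in>F. extensions X Y T)"
    by (rule card_UN_disjoint[symmetric]) (use finF disj finite_subset[OF sub finI] in auto)
  also have "\<dots> \<le> card ?I"
    by (rule card_mono[OF finI]) (use sub in blast)
  \<comment> \<open>Here \<open>card X - card Y\<close> is 1, so the remaining factor is
    \<open>fact 1\<close> and disappears.\<close>
  also have "\<dots> = fact (card X)" using card_inj_PiE[of Y X] Y XY by simp
  finally show ?thesis .
qed

section \<open>The standard model\<close>

lemma bitlen_le_iff: "bitlen x \<le> l \<longleftrightarrow> x < 2 ^ l"
proof
  have "x < 2 ^ bitlen x" unfolding bitlen_def by (rule LeastI[of _ x]) (rule less_exp)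
  moreover assume "bitlen x \<le> l"
  ultimately show "x < 2 ^ l"
    by (meson less_le_trans one_le_numeral power_increasing)
qed (simp add: bitlen_def Least_le)

text \<open>In \<open>elems\<close> a position is given as the length of some \<open>z\<close>; the
  number \<open>2 ^ x - 1\<close> shows that every position is reached.\<close>

lemma bitlen_power_2: "bitlen (2 ^ x - 1) = x"
proof (rule antisym)
  show "bitlen (2 ^ x - 1) \<le> x" by (simp add: bitlen_le_iff)
  show "x \<le> bitlen (2 ^ x - 1)"
  proof (cases x)
    case (Suc y)
    have "\<not> bitlen (2 ^ x - 1) \<le> y" unfolding bitlen_le_iff Suc by simp
    with Suc show ?thesis by simp
  qed simp
qed

lemma bitlen_one [simp]: "bitlen (Suc 0) = Suc 0"
  using bitlen_power_2[of 1] by simp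

lemma nat_arith_simps [simp]:
  "zero nat_arith = 0" "one nat_arith = 1" "half nat_arith x = x div 2" "len nat_arith x = bitlen x"
  "add nat_arith x y = x + y" "mul nat_arith x y = x * y"
  "smash nat_arith x y = 2 ^ (bitlen x * bitlen y)" "less nat_arith x y \<longleftrightarrow> x < y"
  "le nat_arith x y \<longleftrightarrow> x \<le> y" "seg nat_arith x = {..<x}" "two nat_arith = 2"
  by (auto simp: nat_arith_def le_def seg_def two_def)

text \<open>\<open>prod_encode\<close> adds its first component to the triangular number and
  \<open>pair\<close> its second, which explains the exchanged arguments here and the swaps around
  \<open>rel_of\<close>.\<close>

lemma pair_nat [simp]: "pair nat_arith x y = prod_encode (y, x)"
  by (simp add: pair_def prod_encode_def triangle_def add.commute)

lemma elems_nat [simp]: "elems nat_arith s = set_decode s"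
proof -
  have "x \<in> elems nat_arith s \<longleftrightarrow> odd (s div 2 ^ x)" for x
  proof -
    have "x \<in> elems nat_arith s \<longleftrightarrow>
        (\<exists>z u v. bitlen z = x \<and> v < 2 ^ bitlen z \<and> s = (2 * u + 1) * 2 ^ bitlen z + v)"
      unfolding elems_def by simp
    also have "\<dots> \<longleftrightarrow> (\<exists>u v. v < 2 ^ x \<and> s = (2 * u + 1) * 2 ^ x + v)"
      using bitlen_power_2[of x] by metis
    also have "\<dots> \<longleftrightarrow> odd (s div 2 ^ x)"
    proof
      assume "odd (s div 2 ^ x)"
      then obtain u where "s div 2 ^ x = 2 * u + 1" by (elim oddE)
      then have "s = (2 * u + 1) * 2 ^ x + s mod 2 ^ x" using div_mult_mod_eq[of s "2 ^ x"] by simp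
      then show "\<exists>u v. v < 2 ^ x \<and> s = (2 * u + 1) * 2 ^ x + v"
        by (intro exI[of _ u] exI[of _ "s mod 2 ^ x"] conjI) simp_all
    next
      assume "\<exists>u v. v < 2 ^ x \<and> s = (2 * u + 1) * 2 ^ x + v"
      then obtain u v where "v < 2 ^ x" "s = (2 * u + 1) * 2 ^ x + v" by blast
      then have "s div 2 ^ x = 2 * u + 1" by (simp del: mult_Suc add_mult_distrib)
      then show "odd (s div 2 ^ x)" by simp
    qed
    finally show ?thesis .
  qed
  then show ?thesis unfolding set_decode_def by blast
qed

lemma diff0_nat: "y \<le> x \<Longrightarrow> diff0 nat_arith x y = x - y"
  unfolding diff0_def by (rule the0_equality) auto

lemma quot0_nat:
  assumes "0 < y"
  shows "quot0 nat_arith x y = x div y"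
  unfolding quot0_def
proof (rule the0_equality)
  show "\<exists>r. less nat_arith r y \<and> x = add nat_arith (mul nat_arith (x div y) y) r"
    using assms by (intro exI[of _ "x mod y"]) simp
  show "q = x div y" if "\<exists>r. less nat_arith r y \<and> x = add nat_arith (mul nat_arith q y) r" for q
    using that assms by auto
qed

lemma app0_eq:
  assumes "fun_on M f D" and "x \<in> D" and "pair M x y \<in> elems M f"
  shows "app0 M f x = y"
  unfolding app0_def by (rule the0_equality) (use assms in \<open>auto simp: fun_on_def\<close>)

text \<open>The source of all witnesses in the standard model: bijections for \<open>counts\<close>
  and computation sequences for \<open>iterates\<close>.\<close>

lemma ex_fun_on_nat:
  assumes "finite D"
  obtains f where "fun_on nat_arith f D" and "\<And>x. x \<in> D \<Longrightarrow> app0 nat_arith f x = h x"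
proof
  let ?f = "set_encode ((\<lambda>x. prod_encode (h x, x)) ` D)"
  show *: "fun_on nat_arith ?f D" using assms by (auto simp: fun_on_def)
  show "app0 nat_arith ?f x = h x" if "x \<in> D" for x
    by (rule app0_eq[OF *]) (use that assms in auto)
qed

lemma counts_nat: "counts nat_arith s c \<longleftrightarrow> c = card (set_decode s)"
proof
  assume "counts nat_arith s c"
  then show "c = card (set_decode s)" unfolding counts_def by (auto dest: bij_betw_same_card)
next
  assume c: "c = card (set_decode s)"
  obtain h where h: "bij_betw h (set_decode s) {..<c}"
    using ex_bij_betw_finite_nat[of "set_decode s"] c by (auto simp: atLeast0LessThan)
  obtain f where f: "fun_on nat_arith f (set_decode s)"
    "\<And>x. x \<in> set_decode s \<Longrightarrow> app0 nat_arith f x = h x"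
    using ex_fun_on_nat[of "set_decode s" h] by auto
  have "bij_betw (app0 nat_arith f) (set_decode s) {..<c}"
    using h f(2) by (simp cong: bij_betw_cong)
  with f(1) show "counts nat_arith s c" unfolding counts_def by auto
qed

lemma mcard0_nat [simp]: "mcard0 nat_arith s = card (set_decode s)"
  unfolding mcard0_def by (rule the0_equality) (simp_all add: counts_nat)

text \<open>The equivalence includes unique existence of the result for every step function; this is
  what \<open>definable_iter_eq_iter0\<close> transfers.\<close>

lemma iterates_nat: "iterates nat_arith a g l y \<longleftrightarrow> y = rec_nat a g l"
proof
  assume "iterates nat_arith a g l y"
  then obtain p where p: "app0 nat_arith p 0 = a" "app0 nat_arith p l = y"
    "\<And>i. i < l \<Longrightarrow> app0 nat_arith p (Suc i) = g i (app0 nat_arith p i)"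
    unfolding iterates_def by auto
  have "i \<le> l \<Longrightarrow> app0 nat_arith p i = rec_nat a g i" for i
    by (induction i) (use p in auto)
  with p show "y = rec_nat a g l" by auto
next
  assume "y = rec_nat a g l"
  moreover obtain p where "fun_on nat_arith p {..<Suc l}"
    "\<And>x. x \<in> {..<Suc l} \<Longrightarrow> app0 nat_arith p x = rec_nat a g x"
    using ex_fun_on_nat[of "{..<Suc l}" "rec_nat a g"] by auto
  ultimately show "iterates nat_arith a g l y"
    unfolding iterates_def by (intro exI[of _ p]) auto
qed

lemma iter0_nat: "iter0 nat_arith a g l = rec_nat a g l"
  unfolding iter0_def by (rule the0_equality) (simp_all add: iterates_nat)

lemma msum0_nat [simp]: "msum0 nat_arith l f = (\<Sum>i<l. f i)"
  unfolding msum0_def iter0_nat by (induction l) auto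

lemma mfact0_nat [simp]: "mfact0 nat_arith l = fact l"
  unfolding mfact0_def iter0_nat by (induction l) (auto simp: algebra_simps)

lemma array_size0_nat:
  "array_size0 nat_arith m A =
     (\<Sum>a<2 * m. \<Sum>b<m. card (set_decode (entry0 nat_arith A a b)))"
  by (simp add: array_size0_def)

lemma basic_facts_nat: "basic_facts nat_arith"
proof -
  have "x = 0 \<or> x = Suc 0 \<or> 2 \<le> bitlen x" for x
    using bitlen_le_iff[of x 1] by auto
  moreover have "k + k \<le> p * l" if "k \<le> p" "2 \<le> l" for k p l :: nat
    using mult_le_mono[OF that] by simp
  moreover have "\<exists>!z. y + z = x" if "y \<le> x" for x y :: nat
    using that by (intro ex1I[of _ "x - y"]) auto
  moreover have "card (set_decode t) \<le> card (set_decode r) + card (set_decode s)"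
    if "set_decode t = set_decode r \<union> set_decode s" for r s t
    using that card_Un_le by metis
  moreover have "\<exists>!c. counts nat_arith s c" for s by (simp add: counts_nat)
  moreover have "\<exists>!q. \<exists>r<y. x = q * y + r" if "0 < y" for x y :: nat
  proof (rule ex1I[of _ "x div y"])
    show "\<exists>r<y. x = x div y * y + r" using that by (intro exI[of _ "x mod y"]) simp
    show "q = x div y" if "\<exists>r<y. x = q * y + r" for q using that by auto
  qed
  ultimately show ?thesis
    unfolding basic_facts_def
    by (simp add: array_size0_nat)
qed

section \<open>Codes as finite relations\<close>

text \<open>Every natural number is the code of a pair, so that \<open>rel_of\<close> is injective.\<close>

definition rel_of :: "nat \<Rightarrow> (nat \<times> nat) set" where
  "rel_of s = {(x, y). prod_encode (y, x) \<in> set_decode s}"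

lemma rel_of_eq: "rel_of s = (\<lambda>p. prod.swap (prod_decode p)) ` set_decode s"
proof -
  have "(x, y) \<in> (\<lambda>p. prod.swap (prod_decode p)) ` set_decode s"
    if "prod_encode (y, x) \<in> set_decode s" for x y
    using that by (intro image_eqI[of _ _ "prod_encode (y, x)"]) auto
  moreover have "prod_encode (y, x) \<in> set_decode s"
    if "p \<in> set_decode s" "(x, y) = prod.swap (prod_decode p)" for x y p
  proof -
    have "prod_decode p = (y, x)" using that(2) by (cases "prod_decode p") auto
    then show ?thesis using that(1) by (metis prod_decode_inverse)
  qed
  ultimately show ?thesis unfolding rel_of_def by auto
qed

lemma inj_swap_decode: "inj_on (\<lambda>p. prod.swap (prod_decode p)) D"
  unfolding inj_on_def by (metis swap_swap prod_decode_eq)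

lemma finite_rel_of [simp]: "finite (rel_of s)"
  by (simp add: rel_of_eq)

lemma card_rel_of [simp]: "card (rel_of s) = card (set_decode s)"
  by (simp add: rel_of_eq card_image inj_swap_decode)

lemma set_decode_inject: "set_decode s = set_decode t \<longleftrightarrow> s = t"
  by (metis set_decode_inverse)

lemma rel_of_inject: "rel_of s = rel_of t \<longleftrightarrow> s = t"
  unfolding rel_of_eq inj_image_eq_iff[OF inj_swap_decode] set_decode_inject ..

lemma rel_of_Un: "set_decode t = set_decode r \<union> set_decode s \<Longrightarrow> rel_of t = rel_of r \<union> rel_of s"
  unfolding rel_of_def by auto

lemma partial_injection_nat:
  "partial_injection nat_arith n s \<longleftrightarrow> rel_of s \<subseteq> {..<Suc n} \<times> {..<n} \<and> matching (rel_of s)"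
proof -
  have "(\<forall>p \<in> set_decode s. \<exists>x y. x < Suc n \<and> y < n \<and> p = prod_encode (y, x)) \<longleftrightarrow>
      rel_of s \<subseteq> {..<Suc n} \<times> {..<n}"
    (is "?L \<longleftrightarrow> ?R")
  proof
    assume ?L
    then show ?R unfolding rel_of_def by fastforce
  next
    assume R: ?R
    show ?L
    proof
      fix p assume p: "p \<in> set_decode s"
      obtain x y where "p = prod_encode (y, x)" by (metis prod_decode_inverse surj_pair)
      with p R show "\<exists>x y. x < Suc n \<and> y < n \<and> p = prod_encode (y, x)"
        unfolding rel_of_def by blast
    qed
  qed
  moreover have "single_valued (rel_of s) \<longleftrightarrow> (\<forall>x y y'. prod_encode (y, x) \<in> set_decode s \<and>
      prod_encode (y', x) \<in> set_decode s \<longrightarrow> y = y')"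
    unfolding single_valued_def rel_of_def by blast
  moreover have "single_valued ((rel_of s)\<inverse>) \<longleftrightarrow> (\<forall>x x' y. prod_encode (y, x) \<in> set_decode s \<and>
      prod_encode (y, x') \<in> set_decode s \<longrightarrow> x = x')"
    unfolding single_valued_def rel_of_def by blast
  ultimately show ?thesis
    unfolding partial_injection_def matching_def by simp
qed

text \<open>Every finite set of natural numbers has a code, so a common extension exists as soon as
  the union is a matching; the bounds on its points are inherited from both parts.\<close>

lemma compatible0_nat:
  assumes "partial_injection nat_arith n s" and "partial_injection nat_arith n t"
  shows "compatible0 nat_arith n s t \<longleftrightarrow> matching (rel_of s \<union> rel_of t)"
proof
  assume "compatible0 nat_arith n s t"
  then show "matching (rel_of s \<union> rel_of t)"
    unfolding compatible0_def using rel_of_Un partial_injection_nat by auto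
next
  assume m: "matching (rel_of s \<union> rel_of t)"
  let ?u = "set_encode (set_decode s \<union> set_decode t)"
  have u: "set_decode ?u = set_decode s \<union> set_decode t" by simp
  have "partial_injection nat_arith n ?u"
    using assms m unfolding partial_injection_nat rel_of_Un[OF u] by auto
  with u show "compatible0 nat_arith n s t" unfolding compatible0_def by (intro exI[of _ ?u]) simp
qed

text \<open>The array is summed column by column: within a column all conditions are distinct and
  pairwise incompatible, so the matching bound applies to each of the \<open>m\<close>
  columns.\<close>

lemma size_bound_nat: "size_bound nat_arith"
  unfolding size_bound_def
proof (intro allI impI, elim conjE)
  fix n m k \<sigma> A
  assume cols: "uniform_columns nat_arith n m k \<sigma> A"
    and ne: "\<exists>a \<in> seg nat_arith (mul nat_arith (two nat_arith) m). \<exists>b \<in> seg nat_arith m.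
      \<exists>\<tau>. \<tau> \<in> elems nat_arith (entry0 nat_arith A a b)"
  define E where "E a b = set_decode (entry0 nat_arith A a b)" for a b
  define S where "S = rel_of \<sigma>"
  define X where "X = {..<Suc n} - Domain S"
  define Y where "Y = {..<n} - Range S"
  have finE: "finite (E a b)" for a b by (simp add: E_def)
  from cols have S: "S \<subseteq> {..<Suc n} \<times> {..<n}" "matching S"
    and PI_\<sigma>: "partial_injection nat_arith n \<sigma>"
    unfolding uniform_columns_def S_def partial_injection_nat by auto
  have sub: "Domain S \<subseteq> {..<Suc n}" "Range S \<subseteq> {..<n}" using S(1) by auto
  have cS: "card S \<le> n" using card_mono[OF _ sub(2)] card_Range_matching[OF S(2)] by simp
  have X: "finite X" "card X = Suc n - card S"
    unfolding X_def using card_Diff_subset[OF finite_subset[OF sub(1)] sub(1)]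
      card_Domain_matching[OF S(2)] by simp_all
  have Y: "finite Y" "card Y = n - card S"
    unfolding Y_def using card_Diff_subset[OF finite_subset[OF sub(2)] sub(2)]
      card_Range_matching[OF S(2)] by simp_all
  have XY: "card X = Suc (card Y)" using X Y cS by simp
  have entries: "partial_injection nat_arith n \<tau> \<and> card (set_decode \<tau>) = k \<and>
      compatible0 nat_arith n \<tau> \<sigma> \<and> set_decode \<tau> \<inter> set_decode \<sigma> = {}"
    if "a < 2 * m" "b < m" "\<tau> \<in> E a b" for a b \<tau>
    using cols that unfolding uniform_columns_def E_def by simp
  have matchings: "rel_of \<tau> \<subseteq> X \<times> Y \<and> matching (rel_of \<tau>) \<and> card (rel_of \<tau>) = k"
    if "a < 2 * m" "b < m" "\<tau> \<in> E a b" for a b \<tau>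
  proof -
    from entries[OF that] have \<tau>: "partial_injection nat_arith n \<tau>" "card (set_decode \<tau>) = k"
      "compatible0 nat_arith n \<tau> \<sigma>" "set_decode \<tau> \<inter> set_decode \<sigma> = {}" by auto
    have m: "matching (rel_of \<tau> \<union> S)" using \<tau>(3) compatible0_nat[OF \<tau>(1) PI_\<sigma>] S_def by simp
    have d: "rel_of \<tau> \<inter> S = {}" using \<tau>(4) unfolding S_def rel_of_def by auto
    have "x \<in> X \<and> y \<in> Y" if xy: "(x, y) \<in> rel_of \<tau>" for x y
    proof -
      have "x < Suc n" "y < n" using \<tau>(1) xy unfolding partial_injection_nat by auto
      \<comment> \<open>A point shared with \<open>\<sigma>\<close> would, by compatibility, have
        the same partner in both, and the common pair would contradict disjointness.\<close>
      moreover have "x \<notin> Domain S" using matchingD(1)[OF m] xy d by blast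
      moreover have "y \<notin> Range S" using matchingD(2)[OF m] xy d by blast
      ultimately show ?thesis unfolding X_def Y_def by simp
    qed
    with \<tau>(1,2) show ?thesis unfolding partial_injection_nat by auto
  qed
  have disj: "E a b \<inter> E a' b = {}" if "a < 2 * m" "a' < 2 * m" "b < m" "a \<noteq> a'" for a a' b
    using cols that unfolding uniform_columns_def E_def by simp
  have incomp: "\<not> matching (rel_of \<tau> \<union> rel_of \<tau>')"
    if "a < 2 * m" "a' < 2 * m" "b < m" "\<tau> \<in> E a b" "\<tau>' \<in> E a' b" "\<tau> \<noteq> \<tau>'" for a a' b \<tau> \<tau>'
  proof -
    have "\<not> compatible0 nat_arith n \<tau> \<tau>'"
      using cols that unfolding uniform_columns_def E_def by simp
    then show ?thesis using compatible0_nat entries that by blast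
  qed
  have k: "k \<le> card Y"
  proof -
    \<comment> \<open>Any condition of the array is a matching of size \<open>k\<close> into
      \<open>Y\<close>, which leaves no room for a larger \<open>k\<close>.\<close>
    from ne obtain a b \<tau> where "a < 2 * m" "b < m" "\<tau> \<in> E a b" unfolding E_def by auto
    from matchings[OF this] have "Range (rel_of \<tau>) \<subseteq> Y" "card (Range (rel_of \<tau>)) = k"
      by (auto simp: card_Range_matching)
    then show ?thesis using card_mono[OF Y(1)] by metis
  qed
  define N where "N = Suc n - card S"
  have column: "(\<Sum>a<2 * m. card (E a b)) \<le> fact N div fact (N - k)" if b: "b < m" for b
  proof -
    let ?F = "rel_of ` (\<Union>a<2 * m. E a b)"
    \<comment> \<open>By condition (1) no condition occurs in two rows of the same column.\<close>
    have "(\<Sum>a<2 * m. card (E a b)) = card (\<Union>a<2 * m. E a b)"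
      by (rule card_UN_disjoint[symmetric]) (use finE disj b in auto)
    also have "\<dots> = card ?F"
      by (rule card_image[symmetric]) (auto simp: inj_on_def rel_of_inject)
    finally have "(\<Sum>a<2 * m. card (E a b)) = card ?F" .
    moreover have "card ?F * fact (card X - k) \<le> fact (card X)"
    proof (rule card_incompatible_matchings[OF X(1) Y(1) XY])
      show "T \<subseteq> X \<times> Y \<and> matching T \<and> card T = k" if "T \<in> ?F" for T
        using that matchings b by blast
      show "\<not> matching (T \<union> T')" if "T \<in> ?F" "T' \<in> ?F" "T \<noteq> T'" for T T'
        using that incomp b by blast
    qed
    ultimately show ?thesis using X(2) by (simp add: N_def less_eq_div_iff_mult_less_eq)
  qed
  have "array_size0 nat_arith m A = (\<Sum>b<m. \<Sum>a<2 * m. card (E a b))"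
    unfolding array_size0_nat E_def by (rule sum.swap)
  also have "\<dots> \<le> m * (fact N div fact (N - k))"
    using sum_bounded_above[of "{..<m}" "\<lambda>b. \<Sum>a<2 * m. card (E a b)"] column by simp
  finally have size: "array_size0 nat_arith m A \<le> m * (fact N div fact (N - k))" .
  have "card S = card (set_decode \<sigma>)" by (simp add: S_def)
  with cS k Y(2) have *: "diff0 nat_arith (Suc n) (card (set_decode \<sigma>)) = N" "k \<le> N"
    "diff0 nat_arith N k = N - k" "card (set_decode \<sigma>) \<le> Suc n"
    unfolding N_def by (simp_all add: diff0_nat)
  show "le nat_arith (mcard0 nat_arith \<sigma>) (add nat_arith n (one nat_arith)) \<and>
    le nat_arith k (diff0 nat_arith (add nat_arith n (one nat_arith)) (mcard0 nat_arith \<sigma>)) \<and>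
    le nat_arith (array_size0 nat_arith m A)
      (mul nat_arith m (quot0 nat_arith
        (mfact0 nat_arith (diff0 nat_arith (add nat_arith n (one nat_arith)) (mcard0 nat_arith \<sigma>)))
        (mfact0 nat_arith (diff0 nat_arith (diff0 nat_arith (add nat_arith n (one nat_arith))
          (mcard0 nat_arith \<sigma>)) k))))"
    using * size by (simp add: quot0_nat)
qed

section \<open>Models of true arithmetic\<close>

lemma basic_factsD:
  assumes "basic_facts M"
  shows less_SucD: "\<forall>x. less M (zero M) (add M x (one M))"
      "\<forall>x. less M x (add M x (one M))"
      "\<forall>x y. less M x y \<longrightarrow> less M x (add M y (one M))"
      "\<forall>x y. less M x y \<longrightarrow> less M (add M x (one M)) (add M y (one M))"
    and le_transD: "\<forall>x y z. le M x y \<and> le M y z \<longrightarrow> le M x z"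
    and le_doubleD: "\<forall>k p l. le M k p \<and> le M (two M) l \<longrightarrow> le M (add M k k) (mul M p l)"
    and len_ge_twoD: "\<forall>x. x = zero M \<or> x = add M (zero M) (one M) \<or> le M (two M) (len M x)"
    and mul_zeroD: "\<forall>x. mul M (zero M) x = zero M"
    and posD: "\<forall>x. x \<noteq> zero M \<longrightarrow> less M (zero M) x \<and> less M (zero M) (mul M (two M) x)"
    and array_size0_zeroD: "\<forall>A. array_size0 M (zero M) A = zero M"
    and ex1_diffD: "\<forall>x y. le M y x \<longrightarrow> (\<exists>!z. add M y z = x)"
    and ex1_quotD: "\<forall>x y. less M (zero M) y \<longrightarrow>
      (\<exists>!q. \<exists>r. less M r y \<and> x = add M (mul M q y) r)"
    and mfact0_posD: "\<forall>x. less M (zero M) (mfact0 M x)"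
    and ex1_countsD: "\<forall>s. \<exists>!c. counts M s c"
    and mcard0_UnD: "\<forall>r s t. elems M t = elems M r \<union> elems M s \<longrightarrow>
      le M (mcard0 M t) (add M (mcard0 M r) (mcard0 M s))"
  using assms unfolding basic_facts_def by - (elim conjE, assumption)+

section \<open>Agreement of the original notions with their total counterparts\<close>

lemma app_eq_app0: "fun_on M f D \<Longrightarrow> x \<in> D \<Longrightarrow> app M f x = app0 M f x"
  unfolding app_def app0_def by (rule the0_eq_The[symmetric]) (simp add: fun_on_def)

text \<open>Every element codes a set with exactly one internal cardinality, so no assumption on
  \<open>s\<close> is needed. The bijection is evaluated on its domain only, where
  \<open>app\<close> and \<open>app0\<close> coincide.\<close>

lemma mcard_eq_mcard0:
  assumes "basic_facts M"
  shows "mcard M s = mcard0 M s"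
proof -
  have *: "(fun_on M f (elems M s) \<and> bij_betw (app M f) (elems M s) (seg M c)) \<longleftrightarrow>
      (fun_on M f (elems M s) \<and> bij_betw (app0 M f) (elems M s) (seg M c))" for f c
    by (intro conj_cong refl bij_betw_cong app_eq_app0)
  have "mcard M s = (THE c. counts M s c)" unfolding mcard_def counts_def * ..
  moreover have "\<exists>!c. counts M s c" using ex1_countsD[OF assms] ..
  ultimately show ?thesis by (simp add: mcard0_def the0_eq_The)
qed

text \<open>Unique existence is assumed since an external \<open>g\<close> need not have a coded
  sequence of iterates. The order facts place every point at which \<open>p\<close> is evaluated
  inside its domain.\<close>

lemma iter_eq_iter0:
  assumes "basic_facts M" and "\<exists>!y. iterates M a g l y"
  shows "iter M a g l = iter0 M a g l"
proof -
  have seg: "zero M \<in> seg M (add M l (one M))" "l \<in> seg M (add M l (one M))"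
    "\<And>i. less M i l \<Longrightarrow> i \<in> seg M (add M l (one M))"
    "\<And>i. less M i l \<Longrightarrow> add M i (one M) \<in> seg M (add M l (one M))"
    using less_SucD[OF assms(1)] unfolding seg_def by blast+
  have *: "(fun_on M p (seg M (add M l (one M))) \<and> app M p (zero M) = a \<and>
      (\<forall>i. less M i l \<longrightarrow> app M p (add M i (one M)) = g i (app M p i)) \<and> app M p l = y) \<longleftrightarrow>
    (fun_on M p (seg M (add M l (one M))) \<and> app0 M p (zero M) = a \<and>
      (\<forall>i. less M i l \<longrightarrow> app0 M p (add M i (one M)) = g i (app0 M p i)) \<and> app0 M p l = y)" for p y
  proof (intro conj_cong refl)
    assume "fun_on M p (seg M (add M l (one M)))"
    note eq = app_eq_app0[OF this]
    show "app M p (zero M) = a \<longleftrightarrow> app0 M p (zero M) = a" "app M p l = y \<longleftrightarrow> app0 M p l = y"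
      by (simp_all only: eq[OF seg(1)] eq[OF seg(2)])
    have "(less M i l \<longrightarrow> app M p (add M i (one M)) = g i (app M p i)) \<longleftrightarrow>
        (less M i l \<longrightarrow> app0 M p (add M i (one M)) = g i (app0 M p i))" for i
      using eq[OF seg(3), of i] eq[OF seg(4), of i] by metis
    then show "(\<forall>i. less M i l \<longrightarrow> app M p (add M i (one M)) = g i (app M p i)) \<longleftrightarrow>
        (\<forall>i. less M i l \<longrightarrow> app0 M p (add M i (one M)) = g i (app0 M p i))" by blast
  qed
  have "iter M a g l = (THE y. iterates M a g l y)" unfolding iter_def iterates_def * ..
  with assms(2) show ?thesis by (simp add: iter0_def the0_eq_The)
qed

lemma iter_cong: "(\<And>i s. less M i l \<Longrightarrow> g i s = g' i s) \<Longrightarrow> iter M a g l = iter M a g' l"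
  unfolding iter_def by (simp cong: conj_cong)

lemma msum_cong: "(\<And>i. less M i l \<Longrightarrow> f i = f' i) \<Longrightarrow> msum M l f = msum M l f'"
  unfolding msum_def by (rule iter_cong) simp

context
  fixes M :: "'a arith"
  assumes TA: "\<forall>p \<in> true_arithmetic. models M p"
begin

lemma basic_facts: "basic_facts M"
  by (rule transfer_nat[OF TA definable_basic_facts basic_facts_nat])

lemma size_bound: "size_bound M"
  by (rule transfer_nat[OF TA definable_size_bound size_bound_nat])

text \<open>Definability of the step function turns unique existence of the iterate into a formula
  valid in the natural numbers, hence in \<open>M\<close>.\<close>

lemma definable_iter_eq_iter0:
  assumes "definable_fun M nat_arith a a'" and "definable_fun M nat_arith l l'"
    and g: "definable_fun M nat_arith (\<lambda>e. g (e (Suc 0)) (e 0) (\<lambda>n. e (Suc (Suc n))))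
      (\<lambda>e. g' (e (Suc 0)) (e 0) (\<lambda>n. e (Suc (Suc n))))"
  shows "iter M (a e) (\<lambda>i s. g i s e) (l e) = iter0 M (a e) (\<lambda>i s. g i s e) (l e)"
proof -
  have "definable M nat_arith (\<lambda>e. \<exists>!y. iterates M (a e) (\<lambda>i s. g i s e) (l e) y)
     (\<lambda>e. \<exists>!y. iterates nat_arith (a' e) (\<lambda>i s. g' i s e) (l' e) y)"
    unfolding Ex1_def
    by (intro definable_logic definable_iterates definable_fun_subst2[OF _ _ g] definable_arith
        assms(1,2)[THEN definable_fun_rename])
  then have "\<exists>!y. iterates M (a e) (\<lambda>i s. g i s e) (l e) y"
    by (rule transfer_nat[OF TA]) (simp add: iterates_nat)
  then show ?thesis by (rule iter_eq_iter0[OF basic_facts])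
qed

lemma mfact_eq_mfact0: "mfact M l = mfact0 M l"
  unfolding mfact_def mfact0_def
  by (rule definable_iter_eq_iter0[where e = "\<lambda>_. l" and a = "\<lambda>e. one M" and l = "\<lambda>e. e 0"
        and g = "\<lambda>i y e. mul M y (add M i (one M))"
        and a' = "\<lambda>e. one nat_arith" and l' = "\<lambda>e. e 0"
        and g' = "\<lambda>i y e. mul nat_arith y (add nat_arith i (one nat_arith))"])
    (intro definable_arith)+

lemma msum_eq_msum0:
  assumes "definable_fun M nat_arith l l'"
    and "definable_fun M nat_arith (\<lambda>e. f (e 0) (\<lambda>n. e (Suc n))) (\<lambda>e. f' (e 0) (\<lambda>n. e (Suc n)))"
  shows "msum M (l e) (\<lambda>i. f i e) = msum0 M (l e) (\<lambda>i. f i e)"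
  unfolding msum_def msum0_def
  by (rule definable_iter_eq_iter0[where a = "\<lambda>e. zero M" and l = l
        and g = "\<lambda>i y e. add M y (f i e)" and a' = "\<lambda>e. zero nat_arith" and l' = l'
        and g' = "\<lambda>i y e. add nat_arith y (f' i e)"])
    (intro definable_arith assms(1) definable_fun_rename[OF assms(2), of Suc])+

lemma array_size_eq_array_size0:
  assumes "fun_on M A {pair M a b | a b. a \<in> seg M (mul M (two M) m) \<and> b \<in> seg M m}"
  shows "array_size M m A = array_size0 M m A"
proof -
  \<comment> \<open>Definability speaks of functions of an environment, so the parameters
    \<open>m\<close>, \<open>A\<close> and the row \<open>a\<close> of the sums are stored in
    variables 0, 1 and 2.\<close>
  define env where "env a = case_nat m (case_nat A (\<lambda>_. a))" for a
  have env: "env a 0 = m" "env a (Suc 0) = A" "env a (Suc (Suc 0)) = a" for a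
    by (simp_all add: env_def)
  have "msum M (env a 0) (\<lambda>b. mcard0 M (entry0 M (env a (Suc 0)) (env a (Suc (Suc 0))) b)) =
      msum0 M (env a 0) (\<lambda>b. mcard0 M (entry0 M (env a (Suc 0)) (env a (Suc (Suc 0))) b))" for a
    by (rule msum_eq_msum0[where l = "\<lambda>e. e 0" and l' = "\<lambda>e. e 0"
          and f = "\<lambda>b e. mcard0 M (entry0 M (e (Suc 0)) (e (Suc (Suc 0))) b)"
          and f' = "\<lambda>b e. mcard0 nat_arith (entry0 nat_arith (e (Suc 0)) (e (Suc (Suc 0))) b)"])
      (intro definable_arith definable_notions)+
  then have inner: "msum M m (\<lambda>b. mcard0 M (entry0 M A a b)) =
      msum0 M m (\<lambda>b. mcard0 M (entry0 M A a b))" for a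
    unfolding env .
  have "msum M (mul M (two M) (env m 0))
      (\<lambda>a. msum0 M (env m 0) (\<lambda>b. mcard0 M (entry0 M (env m (Suc 0)) a b))) =
    msum0 M (mul M (two M) (env m 0))
      (\<lambda>a. msum0 M (env m 0) (\<lambda>b. mcard0 M (entry0 M (env m (Suc 0)) a b)))"
    by (rule msum_eq_msum0[where l = "\<lambda>e. mul M (two M) (e 0)"
          and l' = "\<lambda>e. mul nat_arith (two nat_arith) (e 0)"
          and f = "\<lambda>a e. msum0 M (e 0) (\<lambda>b. mcard0 M (entry0 M (e (Suc 0)) a b))"
          and f' = "\<lambda>a e. msum0 nat_arith (e 0) (\<lambda>b. mcard0 nat_arith (entry0 nat_arith (e (Suc 0)) a b))"])
      (intro definable_msum0 definable_arith definable_notions)+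
  then have outer: "msum M (mul M (two M) m) (\<lambda>a. msum0 M m (\<lambda>b. mcard0 M (entry0 M A a b))) =
      msum0 M (mul M (two M) m) (\<lambda>a. msum0 M m (\<lambda>b. mcard0 M (entry0 M A a b)))"
    unfolding env .
  have entry: "mcard M (entry M A a b) = mcard0 M (entry0 M A a b)"
    if "less M a (mul M (two M) m)" "less M b m" for a b
  proof -
    have "entry M A a b = entry0 M A a b"
      unfolding entry_def entry0_def by (rule app_eq_app0[OF assms]) (use that in \<open>auto simp: seg_def\<close>)
    then show ?thesis by (simp add: mcard_eq_mcard0[OF basic_facts])
  qed
  have "array_size M m A =
      msum M (mul M (two M) m) (\<lambda>a. msum M m (\<lambda>b. mcard0 M (entry0 M A a b)))"
    unfolding array_size_def by (intro msum_cong entry)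
  then show ?thesis unfolding inner outer array_size0_def .
qed

lemma diff_eq_diff0: "le M y x \<Longrightarrow> diff M x y = diff0 M x y"
  unfolding diff_def diff0_def
  by (rule the0_eq_The[symmetric]) (rule ex1_diffD[OF basic_facts, rule_format])

lemma quot_eq_quot0: "less M (zero M) y \<Longrightarrow> quot M x y = quot0 M x y"
  unfolding quot_def quot0_def
  by (rule the0_eq_The[symmetric]) (rule ex1_quotD[OF basic_facts, rule_format])

section \<open>Eliminating the bounds with a standard exponent\<close>

text \<open>Only 0 and 1 have bit length below two, and both are standard. One further factor
  \<open>len M n\<close> therefore absorbs a doubling.\<close>

lemma two_le_len_nonstandard:
  assumes "n \<notin> range (std M)"
  shows "le M (two M) (len M n)"
proof -
  have "std M 0 = zero M" "std M 1 = add M (zero M) (one M)" by simp_all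
  with assms have "n \<noteq> zero M" "n \<noteq> add M (zero M) (one M)" by (metis rangeI)+
  with len_ge_twoD[OF basic_facts] show ?thesis by blast
qed

text \<open>
  The bound \<open>|n|\<^sup>c\<close> with standard \<open>c\<close> is not expressible inside \<open>M\<close>, but it is preserved under
  doubling, so it does not matter for the compatibility of two small conditions.
\<close>

lemma compatible_if_compatible0:
  assumes "n \<notin> range (std M)" and "le M k (pow M (len M n) c)"
    and "mcard0 M \<sigma> = k" and "mcard0 M \<tau> = k" and "compatible0 M n \<sigma> \<tau>"
  shows "compatible M n \<sigma> \<tau>"
proof -
  obtain \<upsilon> where \<upsilon>: "partial_injection M n \<upsilon>" "elems M \<upsilon> = elems M \<sigma> \<union> elems M \<tau>"
    using assms(5) unfolding compatible0_def by blast
  have "le M (mcard0 M \<upsilon>) (add M k k)"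
    using mcard0_UnD[OF basic_facts, rule_format, OF \<upsilon>(2)] assms(3,4) by simp
  moreover have "le M (add M k k) (mul M (pow M (len M n) c) (len M n))"
    using le_doubleD[OF basic_facts] assms(2) two_le_len_nonstandard[OF assms(1)] by blast
  ultimately have "le M (mcard0 M \<upsilon>) (pow M (len M n) (Suc c))"
    unfolding pow.simps using le_transD[OF basic_facts] by blast
  then have "\<upsilon> \<in> conds M n"
    unfolding conds_def mcard_eq_mcard0[OF basic_facts] using \<upsilon>(1) by blast
  with \<upsilon>(2) show ?thesis unfolding compatible_def by blast
qed

text \<open>Dropping the size bound weakens compatibility with \<open>\<sigma>\<close>, which is
  harmless, but strengthens the incompatibility of two conditions in a column. There the bound on
  \<open>k\<close> enters: a union of two conditions of size \<open>k\<close> is again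
  small.\<close>

lemma uniform_columns_wphp_array:
  assumes n: "n \<notin> range (std M)" and \<sigma>: "\<sigma> \<in> conds M n" and k: "le M k (pow M (len M n) c)"
    and A: "wphp_array M n m k \<sigma> A" and uniform: "uniform M m k A"
  shows "uniform_columns M n m k \<sigma> A"
proof -
  let ?R = "seg M (mul M (two M) m)" and ?C = "seg M m"
  have "fun_on M A {pair M a b | a b. a \<in> ?R \<and> b \<in> ?C}"
    using A unfolding wphp_array_def by (elim conjE)
  then have entry: "entry0 M A a b = entry M A a b" if "a \<in> ?R" "b \<in> ?C" for a b
    unfolding entry_def entry0_def by (rule app_eq_app0[symmetric]) (use that in blast)
  have card: "mcard0 M \<tau> = k" if "a \<in> ?R" "b \<in> ?C" "\<tau> \<in> elems M (entry M A a b)" for a b \<tau>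
    using uniform that unfolding uniform_def mcard_eq_mcard0[OF basic_facts] by blast
  have "\<forall>a \<in> ?R. \<forall>b \<in> ?C. \<forall>\<tau> \<in> elems M (entry M A a b). \<tau> \<in> conds M n \<and> mcard M \<tau> \<preceq>\<^bsub>M\<^esub> k \<and>
      compatible M n \<tau> \<sigma> \<and> elems M \<tau> \<inter> elems M \<sigma> = {}"
    using A unfolding wphp_array_def by (elim conjE)
  then have "\<forall>a \<in> ?R. \<forall>b \<in> ?C. \<forall>\<tau> \<in> elems M (entry M A a b). partial_injection M n \<tau> \<and>
      mcard0 M \<tau> = k \<and> compatible0 M n \<tau> \<sigma> \<and> elems M \<tau> \<inter> elems M \<sigma> = {}"
    using card unfolding compatible_def compatible0_def conds_def by blast
  moreover have "\<forall>a \<in> ?R. \<forall>a' \<in> ?R. \<forall>b \<in> ?C. a \<noteq> a' \<longrightarrow>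
      elems M (entry M A a b) \<inter> elems M (entry M A a' b) = {}"
    using A unfolding wphp_array_def by (elim conjE)
  moreover have "\<forall>a \<in> ?R. \<forall>a' \<in> ?R. \<forall>b \<in> ?C. \<forall>\<tau> \<in> elems M (entry M A a b).
      \<forall>\<tau>' \<in> elems M (entry M A a' b). \<tau> \<noteq> \<tau>' \<longrightarrow> \<not> compatible M n \<tau> \<tau>'"
    using A unfolding wphp_array_def by (elim conjE)
  then have "\<forall>a \<in> ?R. \<forall>a' \<in> ?R. \<forall>b \<in> ?C. \<forall>\<tau> \<in> elems M (entry M A a b).
      \<forall>\<tau>' \<in> elems M (entry M A a' b). \<tau> \<noteq> \<tau>' \<longrightarrow> \<not> compatible0 M n \<tau> \<tau>'"
    using compatible_if_compatible0[OF n k card card] by blast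
  moreover have "partial_injection M n \<sigma>" using \<sigma> unfolding conds_def by blast
  ultimately show ?thesis unfolding uniform_columns_def by (simp add: entry)
qed

end

theorem theorem4p12:
  fixes M :: "'a arith" (structure)
    and n m k \<sigma> A :: 'a
  assumes "countable_nonstandard_model M"
    and "n \<notin> range (std M)"
    and "\<sigma> \<in> conds M n"
    and "\<exists>c::nat. k \<preceq> pow M (len M n) c"
    and "wphp_array M n m k \<sigma> A"
    and "uniform M m k A"
  shows "array_size M m A \<preceq>
    m \<otimes> quot M (mfact M (n \<oplus> \<one> \<ominus> mcard M \<sigma>)) (mfact M (n \<oplus> \<one> \<ominus> mcard M \<sigma> \<ominus> k))"
proof -
  have TA: "\<forall>p \<in> true_arithmetic. models M p"
    using assms(1) unfolding countable_nonstandard_model_def by blast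
  note facts = basic_facts[OF TA]
  have A: "fun_on M A {pair M a b | a b. a \<in> seg M (two M \<otimes> m) \<and> b \<in> seg M m}"
    using assms(5) unfolding wphp_array_def by (elim conjE)
  note size = array_size_eq_array_size0[OF TA A]
  show ?thesis
  proof (cases "m = \<zero>")
    \<comment> \<open>With no rows there is no condition to bound \<open>k\<close>, but both sides
      are zero whatever the subtractions and the quotient mean.\<close>
    case True
    show ?thesis
      unfolding size unfolding True by (simp add: le_def array_size0_zeroD[OF facts] mul_zeroD[OF facts])
  next
    case False
    then have row: "\<zero> \<in> seg M (two M \<otimes> m)" using posD[OF facts] unfolding seg_def by blast
    \<comment> \<open>Condition (4), taken at \<open>\<sigma>\<close> itself and row zero, provides
      the condition that \<open>size_bound\<close> asks for.\<close>
    have "\<forall>\<rho> \<in> conds M n. extends M \<rho> \<sigma> \<longrightarrow>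
        (\<forall>a \<in> seg M (two M \<otimes> m). \<exists>b \<in> seg M m. \<exists>\<tau> \<in> elems M (entry M A a b). compatible M n \<tau> \<rho>)"
      using assms(5) unfolding wphp_array_def by (elim conjE)
    with assms(3) row obtain b \<tau> where b: "b \<in> seg M m" and \<tau>: "\<tau> \<in> elems M (entry M A \<zero> b)"
      unfolding extends_def by blast
    have "entry M A \<zero> b = entry0 M A \<zero> b"
      unfolding entry_def entry0_def by (rule app_eq_app0[OF A]) (use row b in blast)
    with \<tau> row b have ne: "\<exists>a \<in> seg M (two M \<otimes> m). \<exists>b \<in> seg M m. \<exists>\<tau>. \<tau> \<in> elems M (entry0 M A a b)"
      by auto
    obtain c where "k \<preceq> pow M (len M n) c" using assms(4) by blast
    from uniform_columns_wphp_array[OF TA assms(2,3) this assms(5,6)]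
    have cols: "uniform_columns M n m k \<sigma> A" .
    have bound: "mcard0 M \<sigma> \<preceq> n \<oplus> \<one>" "k \<preceq> diff0 M (n \<oplus> \<one>) (mcard0 M \<sigma>)"
      "array_size0 M m A \<preceq> m \<otimes> quot0 M (mfact0 M (diff0 M (n \<oplus> \<one>) (mcard0 M \<sigma>)))
         (mfact0 M (diff0 M (diff0 M (n \<oplus> \<one>) (mcard0 M \<sigma>)) k))"
      using size_bound[OF TA] cols ne unfolding size_bound_def by blast+
    \<comment> \<open>A positive divisor is what makes \<open>quot\<close> agree with
      \<open>quot0\<close>.\<close>
    have "\<zero> \<prec> mfact0 M (diff0 M (diff0 M (n \<oplus> \<one>) (mcard0 M \<sigma>)) k)"
      using mfact0_posD[OF facts] by blast
    with bound show ?thesis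
      by (simp add: size mcard_eq_mcard0[OF basic_facts[OF TA]] diff_eq_diff0[OF TA]
          mfact_eq_mfact0[OF TA] quot_eq_quot0[OF TA])
  qed
qed

end
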